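(* If $G$ is a belt, then $\chi(G)\le\lceil\frac54\omega(G)\rceil$.
   Context: A belt is a $(P_6,C_4,C_6)$-free graph whose vertex set is partitioned into seven sets $Q_1,\dots,Q_5,R_2,R_3$ such that: $Q_1,\dots,Q_5$ are non-empty cliques; $Q_1$ is complete to $Q_2\cup R_2\cup Q_5$ and $Q_4$ is complete to $Q_3\cup R_3\cup Q_5$; $Q_1$ is anticomplete to $Q_3\cup R_3\cup Q_4$, $Q_4$ is anticomplete to $Q_2\cup R_2\cup Q_1$, $Q_5$ is anticomplete to $Q_2\cup R_2\cup Q_3\cup R_3$; for each $j\in\{2,3\}$, $Q_j$ is complete to $R_j$, every vertex of $Q_j\cup R_j$ has a neighbor in $Q_{5-j}\cup R_{5-j}$, and no vertex of $R_j$ is adjacent to all other vertices of $R_j$. Complete/anticomplete: all edges / no edges between the sets. *)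

theory Defs
  imports Complex_Main
begin

definition simple_graph :: "'a set \<Rightarrow> ('a \<Rightarrow> 'a \<Rightarrow> bool) \<Rightarrow> bool" where
  "simple_graph V E \<longleftrightarrow> finite V \<and>
     (\<forall>u v. E u v \<longrightarrow> u \<in> V \<and> v \<in> V \<and> u \<noteq> v \<and> E v u)"

definition has_induced_path :: "'a set \<Rightarrow> ('a \<Rightarrow> 'a \<Rightarrow> bool) \<Rightarrow> nat \<Rightarrow> bool" where
  "has_induced_path V E k \<longleftrightarrow> (\<exists>vs. length vs = k \<and> distinct vs \<and> set vs \<subseteq> V \<and>
     (\<forall>i<k. \<forall>j<k. E (vs!i) (vs!j) \<longleftrightarrow> (i = Suc j \<or> j = Suc i)))"

text \<open>G contains an induced cycle on k vertices (k \<ge> 3).\<close>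
definition has_induced_cycle :: "'a set \<Rightarrow> ('a \<Rightarrow> 'a \<Rightarrow> bool) \<Rightarrow> nat \<Rightarrow> bool" where
  "has_induced_cycle V E k \<longleftrightarrow> (\<exists>vs. length vs = k \<and> distinct vs \<and> set vs \<subseteq> V \<and>
     (\<forall>i<k. \<forall>j<k. E (vs!i) (vs!j) \<longleftrightarrow> (i = Suc j mod k \<or> j = Suc i mod k)))"

definition is_clique :: "('a \<Rightarrow> 'a \<Rightarrow> bool) \<Rightarrow> 'a set \<Rightarrow> bool" where
  "is_clique E K \<longleftrightarrow> (\<forall>x\<in>K. \<forall>y\<in>K. x \<noteq> y \<longrightarrow> E x y)"

definition complete_to :: "('a \<Rightarrow> 'a \<Rightarrow> bool) \<Rightarrow> 'a set \<Rightarrow> 'a set \<Rightarrow> bool" where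
  "complete_to E A B \<longleftrightarrow> (\<forall>a\<in>A. \<forall>b\<in>B. E a b)"

definition anticomplete_to :: "('a \<Rightarrow> 'a \<Rightarrow> bool) \<Rightarrow> 'a set \<Rightarrow> 'a set \<Rightarrow> bool" where
  "anticomplete_to E A B \<longleftrightarrow> (\<forall>a\<in>A. \<forall>b\<in>B. \<not> E a b)"

definition clique_number :: "'a set \<Rightarrow> ('a \<Rightarrow> 'a \<Rightarrow> bool) \<Rightarrow> nat" where
  "clique_number V E = Max {card K | K. K \<subseteq> V \<and> is_clique E K}"

definition proper_colouring :: "'a set \<Rightarrow> ('a \<Rightarrow> 'a \<Rightarrow> bool) \<Rightarrow> nat \<Rightarrow> ('a \<Rightarrow> nat) \<Rightarrow> bool" where
  "proper_colouring V E k f \<longleftrightarrow> (\<forall>v\<in>V. f v < k) \<and> (\<forall>u\<in>V. \<forall>v\<in>V. E u v \<longrightarrow> f u \<noteq> f v)"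

definition chromatic_number :: "'a set \<Rightarrow> ('a \<Rightarrow> 'a \<Rightarrow> bool) \<Rightarrow> nat" where
  "chromatic_number V E = (LEAST k. \<exists>f. proper_colouring V E k f)"

definition belt_partition :: "'a set \<Rightarrow> ('a \<Rightarrow> 'a \<Rightarrow> bool) \<Rightarrow>
    'a set \<Rightarrow> 'a set \<Rightarrow> 'a set \<Rightarrow> 'a set \<Rightarrow> 'a set \<Rightarrow> 'a set \<Rightarrow> 'a set \<Rightarrow> bool" where
  "belt_partition V E Q1 Q2 Q3 Q4 Q5 R2 R3 \<longleftrightarrow>
     simple_graph V E \<and>
     \<not> has_induced_path V E 6 \<and> \<not> has_induced_cycle V E 4 \<and> \<not> has_induced_cycle V E 6 \<and>
     \<comment> \<open>partition of V into seven (pairwise disjoint) sets\<close>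
     Q1 \<union> Q2 \<union> Q3 \<union> Q4 \<union> Q5 \<union> R2 \<union> R3 = V \<and>
     Q1 \<inter> Q2 = {} \<and> Q1 \<inter> Q3 = {} \<and> Q1 \<inter> Q4 = {} \<and> Q1 \<inter> Q5 = {} \<and> Q1 \<inter> R2 = {} \<and> Q1 \<inter> R3 = {} \<and>
     Q2 \<inter> Q3 = {} \<and> Q2 \<inter> Q4 = {} \<and> Q2 \<inter> Q5 = {} \<and> Q2 \<inter> R2 = {} \<and> Q2 \<inter> R3 = {} \<and>
     Q3 \<inter> Q4 = {} \<and> Q3 \<inter> Q5 = {} \<and> Q3 \<inter> R2 = {} \<and> Q3 \<inter> R3 = {} \<and>
     Q4 \<inter> Q5 = {} \<and> Q4 \<inter> R2 = {} \<and> Q4 \<inter> R3 = {} \<and>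
     Q5 \<inter> R2 = {} \<and> Q5 \<inter> R3 = {} \<and>
     R2 \<inter> R3 = {} \<and>
     \<comment> \<open>Q1,...,Q5 are non-empty cliques\<close>
     Q1 \<noteq> {} \<and> Q2 \<noteq> {} \<and> Q3 \<noteq> {} \<and> Q4 \<noteq> {} \<and> Q5 \<noteq> {} \<and>
     is_clique E Q1 \<and> is_clique E Q2 \<and> is_clique E Q3 \<and> is_clique E Q4 \<and> is_clique E Q5 \<and>
     complete_to E Q1 (Q2 \<union> R2 \<union> Q5) \<and> complete_to E Q4 (Q3 \<union> R3 \<union> Q5) \<and>
     anticomplete_to E Q1 (Q3 \<union> R3 \<union> Q4) \<and> anticomplete_to E Q4 (Q2 \<union> R2 \<union> Q1) \<and>
     anticomplete_to E Q5 (Q2 \<union> R2 \<union> Q3 \<union> R3) \<and>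
     complete_to E Q2 R2 \<and> complete_to E Q3 R3 \<and>
     (\<forall>v\<in>Q2 \<union> R2. \<exists>w\<in>Q3 \<union> R3. E v w) \<and>
     (\<forall>v\<in>Q3 \<union> R3. \<exists>w\<in>Q2 \<union> R2. E v w) \<and>
     (\<forall>v\<in>R2. \<not> (\<forall>w\<in>R2. w \<noteq> v \<longrightarrow> E v w)) \<and>
     (\<forall>v\<in>R3. \<not> (\<forall>w\<in>R3. w \<noteq> v \<longrightarrow> E v w))"

definition belt :: "'a set \<Rightarrow> ('a \<Rightarrow> 'a \<Rightarrow> bool) \<Rightarrow> bool" where
  "belt V E \<longleftrightarrow> (\<exists>Q1 Q2 Q3 Q4 Q5 R2 R3. belt_partition V E Q1 Q2 Q3 Q4 Q5 R2 R3)"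

end

theory Submission
  imports Defs
begin

text \<open>
  Let \<open>\<omega>\<close> be the clique number, \<open>k\<close> a number with \<open>4k \<ge> 5\<omega>\<close>, and \<open>N r\<close> the neighbourhood of
  \<open>r \<in> R\<^sub>2\<close> in \<open>Q\<^sub>3 \<union> R\<^sub>3\<close>.  Excluding induced cycles of length 4 and 6 forces \<open>N r \<subseteq> Q\<^sub>3\<close>,
  \<open>Q\<^sub>2\<close> complete to \<open>N r\<close>, and the sets \<open>N r\<close> to be laminar, two elements of \<open>R\<^sub>2\<close> being adjacent
  exactly if their sets meet; symmetrically for \<open>R\<^sub>3\<close>.  Hence \<open>R\<^sub>2\<close> can be coloured greedily by
  decreasing \<open>|N r|\<close>, and this succeeds if enough vertices of each \<open>N r\<close> reuse colours of \<open>Q\<^sub>1\<close>.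
  Let \<open>Q\<^sub>1\<close> and \<open>Q\<^sub>4\<close> share exactly \<open>o = max 0 (|Q\<^sub>1| + |Q\<^sub>4| + |Q\<^sub>5| - k)\<close> colours.  A set of at most
  \<open>|Q\<^sub>1| - o\<close> vertices of \<open>Q\<^sub>3\<close> meets all these demands, so it can take the colours used on \<open>Q\<^sub>1\<close> but
  not on \<open>Q\<^sub>4\<close>; likewise for \<open>Q\<^sub>2\<close>.  The rest of \<open>Q\<^sub>2\<close> and \<open>Q\<^sub>3\<close> fits into the remaining colours
  once colours are shared along a matching of nonadjacent pairs, which exists because the
  neighbourhoods between \<open>Q\<^sub>2\<close> and \<open>Q\<^sub>3\<close> are nested.
\<close>

section \<open>Greedy list colouring, matchings of nonedges, and transversals of laminar
  families\<close>

text \<open>Vertices are coloured by decreasing \<open>m\<close>: the induction removes a vertex of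
  least \<open>m\<close> and colours it last, when all its neighbours in \<open>R\<close> are among
  those counted against \<open>card (L r)\<close>.\<close>

lemma greedy_list_colouring:
  fixes L :: "'a \<Rightarrow> 'c set" and m :: "'a \<Rightarrow> nat"
  assumes "finite R" and "\<And>r. r \<in> R \<Longrightarrow> finite (L r)"
    and "\<And>u v. E u v \<Longrightarrow> E v u"
    and "\<And>r. r \<in> R \<Longrightarrow> card {r' \<in> R. r' \<noteq> r \<and> E r r' \<and> m r \<le> m r'} < card (L r)"
  shows "\<exists>f. (\<forall>r\<in>R. f r \<in> L r) \<and> (\<forall>u\<in>R. \<forall>v\<in>R. u \<noteq> v \<longrightarrow> E u v \<longrightarrow> f u \<noteq> f v)"
  using assms(1,2,4)
proof (induction "card R" arbitrary: R)
  case 0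
  then show ?case by auto
next
  case (Suc n)
  then have "R \<noteq> {}" by auto
  obtain r where r: "r \<in> R" "\<And>r'. r' \<in> R \<Longrightarrow> m r \<le> m r'"
    using ex_min_if_finite[of "m ` R"] Suc.prems(1) \<open>R \<noteq> {}\<close> by (fastforce simp: not_less)
  have fin: "finite (R - {r})" using Suc.prems(1) by simp
  have c: "card {r' \<in> R - {r}. r' \<noteq> q \<and> E q r' \<and> m q \<le> m r'} < card (L q)"
    if "q \<in> R - {r}" for q
  proof -
    have "card {r' \<in> R - {r}. r' \<noteq> q \<and> E q r' \<and> m q \<le> m r'}
        \<le> card {r' \<in> R. r' \<noteq> q \<and> E q r' \<and> m q \<le> m r'}"
      by (rule card_mono) (use Suc.prems(1) in auto)
    also have "\<dots> < card (L q)" using Suc.prems(3)[of q] that by auto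
    finally show ?thesis .
  qed
  have "\<exists>f. (\<forall>q\<in>R - {r}. f q \<in> L q) \<and> (\<forall>u\<in>R - {r}. \<forall>v\<in>R - {r}. u \<noteq> v \<longrightarrow> E u v \<longrightarrow> f u \<noteq> f v)"
    by (rule Suc.hyps(1)[OF _ fin _ c]) (use Suc.hyps(2) r(1) Suc.prems in auto)
  then obtain f where f: "\<forall>q\<in>R - {r}. f q \<in> L q"
    "\<forall>u\<in>R - {r}. \<forall>v\<in>R - {r}. u \<noteq> v \<longrightarrow> E u v \<longrightarrow> f u \<noteq> f v" by blast
  let ?B = "{r' \<in> R. r' \<noteq> r \<and> E r r' \<and> m r \<le> m r'}"
  have "card (f ` ?B) \<le> card ?B" by (rule card_image_le) (use Suc.prems(1) in auto)
  then have "card (f ` ?B) < card (L r)" using Suc.prems(3)[OF r(1)] by linarith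
  then have "\<not> L r \<subseteq> f ` ?B"
    using card_mono[of "f ` ?B" "L r"] Suc.prems(1) by fastforce
  then obtain x where x: "x \<in> L r" "x \<notin> f ` ?B" by auto
  have free: "f v \<noteq> x" if "v \<in> R" "v \<noteq> r" "E r v" for v
    using x(2) that r(2) by auto
  show ?case
  proof (rule exI[of _ "f(r := x)"], intro conjI ballI impI)
    show "(f(r := x)) q \<in> L q" if "q \<in> R" for q using f(1) x(1) that by auto
    show "(f(r := x)) u \<noteq> (f(r := x)) v" if "u \<in> R" "v \<in> R" "u \<noteq> v" "E u v" for u v
      using f(2) free[of u] free[of v] assms(3)[of u v] that by auto
  qed
qed

text \<open>Pairing a vertex whose neighbourhood is largest among the non-full ones with any of its
  non-neighbours lowers the size of a largest clique by one.\<close>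
lemma nested_nonedge_matching:
  assumes "finite A" and "finite B"
    and "\<And>a a'. a \<in> A \<Longrightarrow> a' \<in> A \<Longrightarrow>
          (\<forall>b\<in>B. E a b \<longrightarrow> E a' b) \<or> (\<forall>b\<in>B. E a' b \<longrightarrow> E a b)"
    and "\<And>A' B'. A' \<subseteq> A \<Longrightarrow> B' \<subseteq> B \<Longrightarrow> complete_to E A' B' \<Longrightarrow> card A' + card B' \<le> w"
  shows "\<exists>S p. S \<subseteq> A \<and> inj_on p S \<and> p ` S \<subseteq> B \<and> (\<forall>a\<in>S. \<not> E a (p a)) \<and>
           card A + card B \<le> w + card S"
  using assms
proof (induction "card A" arbitrary: A B w)
  case 0
  have "card A + card B \<le> w"
    by (rule 0(5)) (use 0 in \<open>auto simp: complete_to_def\<close>)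
  then show ?case by (intro exI[of _ "{}"]) auto
next
  case (Suc n)
  let ?N = "\<lambda>a. {b \<in> B. E a b}"
  let ?T = "{a \<in> A. ?N a \<noteq> B}"
  show ?case
  proof (cases "?T = {}")
    case True
    have "card A + card B \<le> w"
      by (rule Suc.prems(4)) (use True in \<open>auto simp: complete_to_def\<close>)
    then show ?thesis by (intro exI[of _ "{}"]) auto
  next
    case False
    define M where "M = Max ((\<lambda>a. card (?N a)) ` ?T)"
    have fT: "finite ?T" using Suc.prems(1) by simp
    have "M \<in> (\<lambda>a. card (?N a)) ` ?T" unfolding M_def
      by (rule Max_in) (use fT False in auto)
    then obtain a where a: "a \<in> ?T" "M = card (?N a)" by blast
    have top: "card (?N a') \<le> card (?N a)" if "a' \<in> ?T" for a'
      unfolding a(2)[symmetric] M_def using fT that by (intro Max_ge) auto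
    have sub: "?N a' \<subseteq> ?N a" if "a' \<in> ?T" for a'
    proof -
      have "?N a' \<subseteq> ?N a \<or> ?N a \<subseteq> ?N a'"
        using Suc.prems(3)[of a a'] a(1) that by auto
      moreover have "?N a = ?N a'" if "?N a \<subseteq> ?N a'"
        by (rule card_seteq) (use that top[OF \<open>a' \<in> ?T\<close>] Suc.prems(2) in auto)
      ultimately show ?thesis by auto
    qed
    obtain b where b: "b \<in> B" "\<not> E a b" using a(1) by auto
    \<comment> \<open>Such a pair can be enlarged by one vertex: by \<open>b\<close> if every vertex
      of \<open>A'\<close> is adjacent to all of \<open>B\<close>, and otherwise by
      \<open>a\<close>, whose neighbourhood contains that of any non-full vertex of
      \<open>A'\<close>.\<close>
    have cl: "card A' + card B' \<le> w - 1 \<and> 1 \<le> w"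
      if h: "A' \<subseteq> A - {a}" "B' \<subseteq> B - {b}" "complete_to E A' B'" for A' B'
    proof -
      have fin: "finite A'" "finite B'" using h Suc.prems(1,2) by (auto intro: finite_subset)
      show ?thesis
      proof (cases "A' \<inter> ?T = {}")
        case True
        have "card A' + card (insert b B') \<le> w"
          by (rule Suc.prems(4)) (use True h b in \<open>auto simp: complete_to_def\<close>)
        moreover have "card (insert b B') = Suc (card B')" using h(2) fin by (intro card_insert_disjoint) auto
        ultimately show ?thesis by simp
      next
        case False
        then obtain a' where a': "a' \<in> A'" "a' \<in> ?T" by auto
        have "E a y" if "y \<in> B'" for y
          using sub[OF a'(2)] that h(2,3) a'(1) by (auto simp: complete_to_def)
        then have "card (insert a A') + card B' \<le> w"
          by (intro Suc.prems(4)) (use h a(1) in \<open>auto simp: complete_to_def\<close>)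
        moreover have "card (insert a A') = Suc (card A')" using h(1) fin by (intro card_insert_disjoint) auto
        ultimately show ?thesis by simp
      qed
    qed
    have w1: "1 \<le> w" using cl[of "{}" "{}"] by (auto simp: complete_to_def)
    have "\<exists>S p. S \<subseteq> A - {a} \<and> inj_on p S \<and> p ` S \<subseteq> B - {b} \<and> (\<forall>a\<in>S. \<not> E a (p a)) \<and>
           card (A - {a}) + card (B - {b}) \<le> (w - 1) + card S"
    proof (rule Suc.hyps(1))
      show "n = card (A - {a})" using Suc.hyps(2) a(1) Suc.prems(1) by simp
    qed (use Suc.prems cl in auto)
    then obtain S p where S: "S \<subseteq> A - {a}" "inj_on p S" "p ` S \<subseteq> B - {b}" "\<forall>a\<in>S. \<not> E a (p a)"
      "card (A - {a}) + card (B - {b}) \<le> (w - 1) + card S" by blast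
    have "finite S" using S(1) Suc.prems(1) by (auto intro: finite_subset)
    then have cS: "card (insert a S) = Suc (card S)" using S(1) by (intro card_insert_disjoint) auto
    have "card A = Suc (card (A - {a}))" "card B = Suc (card (B - {b}))"
      using card_Suc_Diff1[of A a] card_Suc_Diff1[of B b] Suc.prems(1,2) a(1) b(1) by auto
    then have "card A + card B \<le> w + card (insert a S)" using S(5) cS w1 by linarith
    moreover have "inj_on (p(a := b)) (insert a S)"
      using S(1,2,3) by (auto simp: inj_on_def)
    ultimately show ?thesis
      by (intro exI[of _ "insert a S"] exI[of _ "p(a := b)"]) (use S a(1) b in auto)
  qed
qed

text \<open>In a smallest feasible \<open>Z\<close> every element lies in a tight member of the family.  The maximal
  tight members are disjoint and each contains at least \<open>s\<close> elements outside \<open>Z\<close>.\<close>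
lemma laminar_small_transversal:
  fixes N :: "'a \<Rightarrow> 'b set" and cap :: "'a \<Rightarrow> nat"
  assumes "finite X" and sub: "\<And>r. r \<in> R \<Longrightarrow> N r \<subseteq> X"
    and lam: "\<And>r r'. r \<in> R \<Longrightarrow> r' \<in> R \<Longrightarrow> N r \<inter> N r' = {} \<or> N r \<subseteq> N r' \<or> N r' \<subseteq> N r"
    and cap: "\<And>r. r \<in> R \<Longrightarrow> s \<le> cap r"
    and one: "\<And>r. r \<in> R \<Longrightarrow> card (N r) \<le> cap r + t"
    and X4: "card X \<le> 4 * s"
    and two: "(\<forall>r\<in>R. card (N r) + s \<le> cap r + t) \<or> card X \<le> t + 2 * s"
  shows "\<exists>Z\<subseteq>\<Union>(N ` R). card Z \<le> t \<and> (\<forall>r\<in>R. card (N r - Z) \<le> cap r)"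
proof -
  let ?ok = "\<lambda>Z. Z \<subseteq> \<Union>(N ` R) \<and> (\<forall>r\<in>R. card (N r - Z) \<le> cap r)"
  have finU: "finite (\<Union>(N ` R))" using assms(1) sub by (meson UN_least finite_subset)
  have finN: "finite (N r)" if "r \<in> R" for r using sub[OF that] assms(1) finite_subset by blast
  have "?ok (\<Union>(N ` R))"
  proof -
    have "card (N r - \<Union>(N ` R)) = 0" if "r \<in> R" for r using that by (metis Diff_eq_empty_iff UN_upper card.empty)
    then show ?thesis by simp
  qed
  then have "\<exists>Z. ?ok Z \<and> (\<forall>Z'. ?ok Z' \<longrightarrow> card Z \<le> card Z')"
    by (rule ex_has_least_nat)
  then obtain Z where Z: "?ok Z" "\<And>Z'. ?ok Z' \<Longrightarrow> card Z \<le> card Z'"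
    by (elim exE conjE) (rule that, blast+)
  have finZ: "finite Z" using Z(1) finU finite_subset by blast
  let ?tight = "\<lambda>r. r \<in> R \<and> card (N r - Z) = cap r"
  have tight: "\<exists>r. ?tight r \<and> z \<in> N r" if "z \<in> Z" for z
  proof (rule ccontr)
    assume c: "\<nexists>r. ?tight r \<and> z \<in> N r"
    have "card (N r - (Z - {z})) \<le> cap r" if r: "r \<in> R" for r
    proof (cases "z \<in> N r")
      case True
      then have "N r - (Z - {z}) = insert z (N r - Z)" by auto
      then have "card (N r - (Z - {z})) \<le> Suc (card (N r - Z))"
        using finN[OF r] by (simp add: card_insert_if)
      moreover have "card (N r - Z) \<noteq> cap r" using c True r by blast
      moreover have "card (N r - Z) \<le> cap r" using Z(1) r by blast
      ultimately show ?thesis by linarith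
    next
      case False
      then have "N r - (Z - {z}) = N r - Z" by auto
      then show ?thesis using Z(1) r by simp
    qed
    moreover have "Z - {z} \<subseteq> \<Union>(N ` R)" using Z(1) by blast
    ultimately have "?ok (Z - {z})" by simp
    from Z(2)[OF this] have "card Z \<le> card (Z - {z})" .
    then show False using that finZ by (metis card_Diff1_less not_le)
  qed
  have maxtight: "\<exists>r. ?tight r \<and> z \<in> N r \<and>
      (\<forall>r'. ?tight r' \<and> N r \<subseteq> N r' \<longrightarrow> N r' = N r)" if "z \<in> Z" for z
  proof -
    obtain r0 where r0: "?tight r0 \<and> z \<in> N r0" using tight \<open>z \<in> Z\<close> by blast
    have bnd: "\<forall>y. (?tight y \<and> z \<in> N y) \<longrightarrow> card (N y) < Suc (card X)"
      using sub card_mono[OF assms(1)] by (simp add: less_Suc_eq_le)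
    obtain r where r: "?tight r \<and> z \<in> N r"
      "\<forall>y. (?tight y \<and> z \<in> N y) \<longrightarrow> card (N y) \<le> card (N r)"
      using ex_has_greatest_nat[of "\<lambda>y. ?tight y \<and> z \<in> N y", OF r0 bnd] by (elim exE conjE) (rule that, blast+)
    have "N r' = N r" if "?tight r'" "N r \<subseteq> N r'" for r'
    proof -
      have "z \<in> N r'" using that(2) r(1) by blast
      then have "card (N r') \<le> card (N r)" using r(2) that(1) by blast
      then show ?thesis using card_seteq[OF finN that(2)] that(1) by simp
    qed
    then show ?thesis using r(1) by blast
  qed
  have cardN: "card (N r \<inter> Z) + card (N r - Z) = card (N r)" if "r \<in> R" for r
    using card_Int_Diff[OF finN[OF that], of Z] by simp
  have posn: "0 < card (N r \<inter> Z)" if "r \<in> R" "z \<in> Z" "z \<in> N r" for r z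
    using finN[OF that(1)] that by (auto simp: card_gt_0_iff)
  have finX: "finite X" by fact
  have ZX: "Z \<subseteq> X" using Z(1) sub by blast
  have cardX: "card Z + card (X - Z) = card X"
    using card_Int_Diff[OF finX, of Z] ZX by (simp add: Int_absorb1)
  have "card Z \<le> t"
  proof (cases "Z = {}")
    case False
    then obtain z1 where z1: "z1 \<in> Z" by auto
    obtain r1 where r1: "r1 \<in> R" "card (N r1 - Z) = cap r1" "z1 \<in> N r1"
      "\<And>r'. ?tight r' \<Longrightarrow> N r1 \<subseteq> N r' \<Longrightarrow> N r' = N r1"
      using maxtight[OF z1] by blast
    note c1 = cardN[OF r1(1)] one[OF r1(1)] cap[OF r1(1)] posn[OF r1(1) z1 r1(3)]
    show ?thesis
    proof (cases "Z \<subseteq> N r1")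
      case True
      then have "N r1 \<inter> Z = Z" by auto
      then show ?thesis using c1 r1(2) by simp
    next
      case False
      then obtain z2 where z2: "z2 \<in> Z" "z2 \<notin> N r1" by auto
      obtain r2 where r2: "r2 \<in> R" "card (N r2 - Z) = cap r2" "z2 \<in> N r2"
        "\<And>r'. ?tight r' \<Longrightarrow> N r2 \<subseteq> N r' \<Longrightarrow> N r' = N r2"
        using maxtight[OF z2(1)] by blast
      note c2 = cardN[OF r2(1)] one[OF r2(1)] cap[OF r2(1)] posn[OF r2(1) z2(1) r2(3)]
      have d12: "N r1 \<inter> N r2 = {}"
        using lam[OF r1(1) r2(1)] r1(4)[of r2] r2 z2(2) by blast
      have X12: "card (N r1) + card (N r2) \<le> card X"
        using card_Un_disjoint[of "N r1" "N r2"] d12 finN r1(1) r2(1) sub card_mono[OF finX]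
        by (metis Un_least)
      have U12: "card (N r1 - Z) + card (N r2 - Z) \<le> card (X - Z)"
      proof -
        have "card ((N r1 - Z) \<union> (N r2 - Z)) = card (N r1 - Z) + card (N r2 - Z)"
          by (rule card_Un_disjoint) (use d12 finN r1(1) r2(1) in auto)
        moreover have "card ((N r1 - Z) \<union> (N r2 - Z)) \<le> card (X - Z)"
          by (rule card_mono) (use finX sub r1(1) r2(1) in auto)
        ultimately show ?thesis by simp
      qed
      show ?thesis
      proof (cases "card X \<le> t + 2 * s")
        case True
        then show ?thesis using cardX U12 c1 c2 r1(2) r2(2) by linarith
      next
        case False
        then have e: "card (N r1) + s \<le> cap r1 + t" "card (N r2) + s \<le> cap r2 + t"
          using two r1(1) r2(1) by auto
        show ?thesis
        proof (cases "Z \<subseteq> N r1 \<union> N r2")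
          case True
          \<comment> \<open>Each of the two parts of \<open>Z\<close> has at most
            \<open>t - s\<close> elements, and together they have at most
            \<open>card X - 2 * s \<le> 2 * s\<close>. The average of the bounds
            \<open>2 * (t - s)\<close> and \<open>2 * s\<close> is \<open>t\<close>.\<close>
          then have "Z = (N r1 \<inter> Z) \<union> (N r2 \<inter> Z)" by auto
          then have "card Z \<le> card (N r1 \<inter> Z) + card (N r2 \<inter> Z)" by (metis card_Un_le)
          then show ?thesis using c1 c2 e X12 X4 r1(2) r2(2) by linarith
        next
          case False
          then obtain z3 where z3: "z3 \<in> Z" "z3 \<notin> N r1" "z3 \<notin> N r2" by auto
          obtain r3 where r3: "r3 \<in> R" "card (N r3 - Z) = cap r3" "z3 \<in> N r3"
            using tight[OF z3(1)] by blast
          have d13: "N r1 \<inter> N r3 = {}" "N r2 \<inter> N r3 = {}"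
            using lam[OF r1(1) r3(1)] lam[OF r2(1) r3(1)] r1(4)[of r3] r2(4)[of r3] r3 z3 by blast+
          \<comment> \<open>Three disjoint tight sets leave
            \<open>card Z \<le> card X - 3 * s \<le> s\<close>. Moreover \<open>s < t\<close>,
            because \<open>N r1\<close> meets \<open>Z\<close> in at least one and at most
            \<open>t - s\<close> elements.\<close>
          have "card (((N r1 - Z) \<union> (N r2 - Z)) \<union> (N r3 - Z))
              = card (N r1 - Z) + card (N r2 - Z) + card (N r3 - Z)"
            using d12 d13 finN r1(1) r2(1) r3(1)
            by (subst card_Un_disjoint, auto)+
          moreover have "card (((N r1 - Z) \<union> (N r2 - Z)) \<union> (N r3 - Z)) \<le> card (X - Z)"
            by (rule card_mono) (use finX sub r1(1) r2(1) r3(1) in auto)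
          ultimately show ?thesis
            using c1 c2 e cap[OF r3(1)] cardX X4 r1(2) r2(2) r3(2) by linarith
        qed
      qed
    qed
  qed simp
  then show ?thesis using Z(1) by blast
qed

section \<open>Colouring two cliques from overlapping palettes\<close>

lemma inj_into_larger:
  assumes "finite A" "finite C" "card A \<le> card C"
  obtains f where "inj_on f A" "f ` A \<subseteq> C"
  using card_le_inj[OF assms] by blast

text \<open>\<open>D\<close> is filled before \<open>H\<close> is touched: \<open>W\<close> goes in
  first, then further elements of \<open>A - S\<close> while there is room, so that \<open>H\<close>
  only has to hold the overflow.\<close>

lemma inj_on_extension_two_palettes:
  assumes "finite A" "finite D" "finite H" "D \<inter> H = {}" "S \<subseteq> A" "W \<subseteq> A - S"
    and "inj_on e S" "e ` S \<inter> (D \<union> H) = {}"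
    and "card W \<le> card D" "card A - card S - card D \<le> card H"
  shows "\<exists>f. inj_on f A \<and> (\<forall>a\<in>S. f a = e a) \<and> f ` W \<subseteq> D \<and> f ` (A - S) \<subseteq> D \<union> H"
proof -
  have fS: "finite S" "finite (A - S)" using assms finite_subset by auto
  have cAS: "card (A - S) = card A - card S" by (rule card_Diff_subset) (use fS assms in auto)
  have WA: "card W \<le> card (A - S)" by (rule card_mono) (use fS assms in auto)
  obtain T where T: "W \<subseteq> T" "T \<subseteq> A - S" "card T = min (card D) (card (A - S))"
    using exists_subset_between[of W "min (card D) (card (A - S))" "A - S"] assms fS WA by auto
  have fT: "finite T" using T(2) fS finite_subset by auto
  obtain g where g: "inj_on g T" "g ` T \<subseteq> D"
    using inj_into_larger[of T D] fT T(3) assms(2) by auto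
  have "card (A - S - T) = card (A - S) - card T" by (rule card_Diff_subset) (use fT T in auto)
  then have "card (A - S - T) \<le> card H" using T(3) cAS assms(10) by linarith
  then obtain h where h: "inj_on h (A - S - T)" "h ` (A - S - T) \<subseteq> H"
    using inj_into_larger[of "A - S - T" H] fS assms(3) by auto
  define f where "f = (\<lambda>a. if a \<in> S then e a else if a \<in> T then g a else h a)"
  have "inj_on f A"
  proof (rule inj_onI)
    fix x y assume xy: "x \<in> A" "y \<in> A" "f x = f y"
    have ranges: "a \<in> S \<Longrightarrow> e a \<notin> D \<union> H" "a \<in> T \<Longrightarrow> g a \<in> D \<and> g a \<notin> H"
      "a \<in> A - S - T \<Longrightarrow> h a \<in> H \<and> h a \<notin> D" for a
      using assms(4,8) g(2) h(2) by blast+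
    show "x = y"
      using xy ranges[of x] ranges[of y] inj_onD[OF assms(7)] inj_onD[OF g(1)] inj_onD[OF h(1)]
      by (auto simp: f_def split: if_splits)
  qed
  moreover have "\<forall>a\<in>S. f a = e a" by (simp add: f_def)
  moreover have "f ` W \<subseteq> D" using T(1,2) g(2) by (auto simp: f_def)
  moreover have "f ` (A - S) \<subseteq> D \<union> H" using g(2) h(2) by (auto simp: f_def)
  ultimately show ?thesis by blast
qed

text \<open>One colour of \<open>G\<close> serves both \<open>a\<close> and \<open>p a\<close>. The
  rest of \<open>A\<close> goes into \<open>D'\<close> and the rest of \<open>B\<close> into
  \<open>D\<close> as far as possible, and the two overflows take disjoint parts of
  \<open>G\<close>; \<open>num\<close> says that \<open>G\<close> has room for all three
  demands.\<close>

lemma colour_two_cliques_sharing: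
  fixes D D' G :: "'c set"
  assumes fin: "finite A" "finite B" "finite D" "finite D'" "finite G"
    and dis: "D \<inter> D' = {}" "D \<inter> G = {}" "D' \<inter> G = {}"
    and S: "S \<subseteq> A" "inj_on p S" "p ` S \<subseteq> B"
    and W: "W \<subseteq> A - S" "card W \<le> card D'"
    and Z: "Z \<subseteq> B - p ` S" "card Z \<le> card D"
    and num: "card S + (card A - card S - card D') + (card B - card S - card D) \<le> card G"
  shows "\<exists>f g. inj_on f A \<and> f ` A \<subseteq> D' \<union> G \<and> f ` W \<subseteq> D' \<and>
           inj_on g B \<and> g ` B \<subseteq> D \<union> G \<and> g ` Z \<subseteq> D \<and>
           (\<forall>a\<in>A. \<forall>b\<in>B. f a = g b \<longrightarrow> a \<in> S \<and> b = p a)"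
proof -
  have fS: "finite S" using S(1) fin finite_subset by auto
  obtain G0 where G0: "G0 \<subseteq> G" "card G0 = card S"
    using obtain_subset_with_card_n[of "card S" G] num by auto
  have fG0: "finite G0" "finite (G - G0)" using G0 fin finite_subset by auto
  have cG: "card (G - G0) = card G - card S" using G0 fG0 by (simp add: card_Diff_subset)
  have "card A - card S - card D' \<le> card (G - G0)" using num cG by linarith
  then obtain H where H: "H \<subseteq> G - G0" "card H = card A - card S - card D'"
    using obtain_subset_with_card_n[of "card A - card S - card D'" "G - G0"] by blast
  have fH: "finite H" using H(1) fG0 finite_subset by auto
  have cGH: "card (G - G0 - H) = card G - card S - card H"
    using card_Diff_subset[OF fH H(1)] cG by simp
  obtain e where e: "inj_on e S" "e ` S \<subseteq> G0"
    using inj_into_larger[of S G0] fS fG0 G0(2) by auto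
  \<comment> \<open>\<open>e'\<close> copies the colour of each \<open>a\<close> in \<open>S\<close>
    to its partner \<open>p a\<close>.\<close>
  define e' where "e' = (\<lambda>b. e (inv_into S p b))"
  have e'p: "e' (p a) = e a" if "a \<in> S" for a using that S(2) by (simp add: e'_def)
  have e'im: "e' ` p ` S = e ` S" using e'p by (force simp: image_iff)
  have im: "e ` S \<inter> (D' \<union> H) = {}" using e(2) G0(1) H(1) dis by blast
  have "D' \<inter> H = {}" using H(1) dis by blast
  then have "\<exists>f. inj_on f A \<and> (\<forall>a\<in>S. f a = e a) \<and> f ` W \<subseteq> D' \<and> f ` (A - S) \<subseteq> D' \<union> H"
    using inj_on_extension_two_palettes[OF fin(1) fin(4) fH _ S(1) W(1) e(1) im W(2)] H(2) by simp
  then obtain f where f: "inj_on f A" "\<forall>a\<in>S. f a = e a" "f ` W \<subseteq> D'" "f ` (A - S) \<subseteq> D' \<union> H"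
    by blast
  have inj': "inj_on e' (p ` S)"
    using e(1) e'p by (auto simp: inj_on_def)
  have im': "e' ` p ` S \<inter> (D \<union> (G - G0 - H)) = {}"
    using e'im e(2) G0(1) dis by blast
  have cp: "card (p ` S) = card S" using S(2) by (rule card_image)
  have "\<exists>g. inj_on g B \<and> (\<forall>b\<in>p ` S. g b = e' b) \<and> g ` Z \<subseteq> D \<and> g ` (B - p ` S) \<subseteq> D \<union> (G - G0 - H)"
    by (rule inj_on_extension_two_palettes[OF _ _ _ _ S(3) Z(1) inj' im'])
      (use fin fG0 dis Z cp num cGH H(2) in auto)
  then obtain g where g: "inj_on g B" "\<forall>b\<in>p ` S. g b = e' b" "g ` Z \<subseteq> D"
    "g ` (B - p ` S) \<subseteq> D \<union> (G - G0 - H)" by blast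
  have fr: "f a \<in> G0" if "a \<in> S" for a using f(2) e(2) that by auto
  have fr': "f a \<in> D' \<union> H" if "a \<in> A - S" for a using f(4) that by auto
  have gr: "g b \<in> G0" if "b \<in> p ` S" for b using g(2) e(2) that e'p by auto
  have gr': "g b \<in> D \<union> (G - G0 - H)" if "b \<in> B - p ` S" for b using g(4) that by auto
  have "a \<in> S \<and> b = p a" if ab: "a \<in> A" "b \<in> B" "f a = g b" for a b
  proof (cases "a \<in> S")
    case True
    then have "b \<in> p ` S" using fr[OF True] gr'[of b] ab G0(1) dis by auto
    then obtain a' where a': "a' \<in> S" "b = p a'" by auto
    then have "e a = e a'" using f(2) g(2) e'p ab(3) True by auto
    then show ?thesis using a' True e(1) by (auto dest: inj_onD)
  next
    case False
    then have "f a \<in> D' \<union> H" using fr' ab(1) False by blast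
    moreover have "g b \<in> G0 \<or> g b \<in> D \<union> (G - G0 - H)" using gr gr' ab(2) by blast
    ultimately show ?thesis using ab(3) G0(1) H(1) dis by auto
  qed
  moreover have "f ` A \<subseteq> D' \<union> G" using fr fr' G0(1) H(1) by blast
  moreover have "g ` B \<subseteq> D \<union> G" using gr gr' G0(1) by blast
  ultimately show ?thesis using f(1,3) g(1,3) by blast
qed

text \<open>Here \<open>z\<close> counts the colours common to \<open>Q1\<close> and
  \<open>Q4\<close>, \<open>x\<close> and \<open>y\<close> those on only one of them, and
  \<open>a\<close> and \<open>b\<close> are the sizes of \<open>Q2\<close> and \<open>Q3\<close>.
  Shared pairs and both overflows must fit into the colours on neither \<open>Q1\<close> nor
  \<open>Q4\<close>; the two sides agree when no subtraction truncates.\<close>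

lemma palette_arith:
  fixes x y :: nat
  assumes "x + z + a \<le> k" "b + y + z \<le> k" "x + y + z \<le> k"
  shows "(a + b + z - k) + (a - (a + b + z - k) - y) + (b - (a + b + z - k) - x) \<le> k - (x + (y + z))"
  using assms by linarith

lemma all_less_4: "(\<forall>i<(4::nat). P i) \<longleftrightarrow> P 0 \<and> P 1 \<and> P 2 \<and> P 3"
  by (simp add: numeral_eq_Suc All_less_Suc) blast

lemma all_less_6: "(\<forall>i<(6::nat). P i) \<longleftrightarrow> P 0 \<and> P 1 \<and> P 2 \<and> P 3 \<and> P 4 \<and> P 5"
  by (simp add: numeral_eq_Suc All_less_Suc) blast

section \<open>The belt and its basic adjacencies\<close>

locale belt_graph =
  fixes V :: "'a set" and E Q1 Q2 Q3 Q4 Q5 R2 R3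
  assumes partition: "belt_partition V E Q1 Q2 Q3 Q4 Q5 R2 R3"
begin

lemmas parts = partition[unfolded belt_partition_def]

lemma V_eq: "V = Q1 \<union> Q2 \<union> Q3 \<union> Q4 \<union> Q5 \<union> R2 \<union> R3"
  by (rule HOL.sym) (insert parts, elim conjE, assumption)

lemma disjoint:
  "Q1 \<inter> Q2 = {}" "Q1 \<inter> Q3 = {}" "Q1 \<inter> Q4 = {}" "Q1 \<inter> Q5 = {}" "Q1 \<inter> R2 = {}" "Q1 \<inter> R3 = {}"
  "Q2 \<inter> Q3 = {}" "Q2 \<inter> Q4 = {}" "Q2 \<inter> Q5 = {}" "Q2 \<inter> R2 = {}" "Q2 \<inter> R3 = {}"
  "Q3 \<inter> Q4 = {}" "Q3 \<inter> Q5 = {}" "Q3 \<inter> R2 = {}" "Q3 \<inter> R3 = {}"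
  "Q4 \<inter> Q5 = {}" "Q4 \<inter> R2 = {}" "Q4 \<inter> R3 = {}" "Q5 \<inter> R2 = {}" "Q5 \<inter> R3 = {}" "R2 \<inter> R3 = {}"
  by (insert parts, (elim conjE, assumption)+)

lemma graph: "simple_graph V E" and no_cycles: "\<not> has_induced_cycle V E 4" "\<not> has_induced_cycle V E 6"
  by (insert parts, (elim conjE, assumption)+)

lemma nonempty: "Q1 \<noteq> {}" "Q2 \<noteq> {}" "Q3 \<noteq> {}" "Q4 \<noteq> {}" "Q5 \<noteq> {}"
  by (insert parts, (elim conjE, assumption)+)

lemma is_cliques: "is_clique E Q1" "is_clique E Q2" "is_clique E Q3" "is_clique E Q4" "is_clique E Q5"
  by (insert parts, (elim conjE, assumption)+)

lemma completes: "complete_to E Q1 (Q2 \<union> R2 \<union> Q5)" "complete_to E Q4 (Q3 \<union> R3 \<union> Q5)"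
  "complete_to E Q2 R2" "complete_to E Q3 R3"
  by (insert parts, (elim conjE, assumption)+)

lemma anticompletes: "anticomplete_to E Q1 (Q3 \<union> R3 \<union> Q4)" "anticomplete_to E Q4 (Q2 \<union> R2 \<union> Q1)"
  "anticomplete_to E Q5 (Q2 \<union> R2 \<union> Q3 \<union> R3)"
  by (insert parts, (elim conjE, assumption)+)

lemma neighbours: "\<forall>v\<in>Q2 \<union> R2. \<exists>w\<in>Q3 \<union> R3. E v w"
  "\<forall>v\<in>R2. \<not> (\<forall>w\<in>R2. w \<noteq> v \<longrightarrow> E v w)"
  by (insert parts, (elim conjE, assumption)+)

text \<open>The definition is invariant under the reflection exchanging indices 1 with 4 and 2 with
  3. Interpreting the locale at the reflected sets turns each result on \<open>R2\<close> into one
  on \<open>R3\<close>.\<close>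

lemma swap: "belt_graph V E Q4 Q3 Q2 Q1 Q5 R3 R2"
proof -
  have "Q4 \<union> Q3 \<union> Q2 \<union> Q1 \<union> Q5 \<union> R3 \<union> R2 = V" using V_eq by (simp add: Un_ac)
  moreover have "anticomplete_to E Q5 (Q3 \<union> R3 \<union> Q2 \<union> R2)"
    using anticompletes(3) by (simp add: Un_ac)
  ultimately show ?thesis
    unfolding belt_graph_def belt_partition_def
    by (insert parts, elim conjE, intro conjI) (assumption | rule trans[OF Int_commute], assumption)+
qed

lemma sym: "E u v \<Longrightarrow> E v u" and irrefl: "\<not> E u u" and finV: "finite V"
  and edge_in_V: "E u v \<Longrightarrow> u \<in> V"
  using graph unfolding simple_graph_def by blast+

lemma in_V: "v \<in> Q1 \<Longrightarrow> v \<in> V" "v \<in> Q2 \<Longrightarrow> v \<in> V" "v \<in> Q3 \<Longrightarrow> v \<in> V" "v \<in> Q4 \<Longrightarrow> v \<in> V"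
  "v \<in> Q5 \<Longrightarrow> v \<in> V" "v \<in> R2 \<Longrightarrow> v \<in> V" "v \<in> R3 \<Longrightarrow> v \<in> V"
  by (simp_all add: V_eq)

lemma fin: "finite Q1" "finite Q2" "finite Q3" "finite Q4" "finite Q5" "finite R2" "finite R3"
  using finV V_eq by simp_all

lemma clique:
  "u \<in> Q1 \<Longrightarrow> v \<in> Q1 \<Longrightarrow> u \<noteq> v \<Longrightarrow> E u v"
  "u \<in> Q2 \<Longrightarrow> v \<in> Q2 \<Longrightarrow> u \<noteq> v \<Longrightarrow> E u v"
  "u \<in> Q3 \<Longrightarrow> v \<in> Q3 \<Longrightarrow> u \<noteq> v \<Longrightarrow> E u v"
  "u \<in> Q4 \<Longrightarrow> v \<in> Q4 \<Longrightarrow> u \<noteq> v \<Longrightarrow> E u v"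
  "u \<in> Q5 \<Longrightarrow> v \<in> Q5 \<Longrightarrow> u \<noteq> v \<Longrightarrow> E u v"
  using is_cliques unfolding is_clique_def by simp_all

lemma adj:
  "u \<in> Q1 \<Longrightarrow> v \<in> Q2 \<union> R2 \<union> Q5 \<Longrightarrow> E u v"
  "u \<in> Q4 \<Longrightarrow> v \<in> Q3 \<union> R3 \<union> Q5 \<Longrightarrow> E u v"
  "u \<in> Q2 \<Longrightarrow> v \<in> R2 \<Longrightarrow> E u v"
  "u \<in> Q3 \<Longrightarrow> v \<in> R3 \<Longrightarrow> E u v"
  using completes unfolding complete_to_def by simp_all

lemma nonadj:
  "u \<in> Q1 \<Longrightarrow> v \<in> Q3 \<union> R3 \<union> Q4 \<Longrightarrow> \<not> E u v"
  "u \<in> Q4 \<Longrightarrow> v \<in> Q2 \<union> R2 \<union> Q1 \<Longrightarrow> \<not> E u v"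
  "u \<in> Q5 \<Longrightarrow> v \<in> Q2 \<union> R2 \<union> Q3 \<union> R3 \<Longrightarrow> \<not> E u v"
  using anticompletes unfolding anticomplete_to_def by simp_all

lemma cross_neighbour: "v \<in> Q2 \<union> R2 \<Longrightarrow> \<exists>w\<in>Q3 \<union> R3. E v w"
  using neighbours(1) by blast

lemma nonneighbour: "v \<in> R2 \<Longrightarrow> \<exists>w\<in>R2. w \<noteq> v \<and> \<not> E v w"
  using neighbours(2) by blast

lemma no_C4:
  assumes "E a b" "E b c" "E c d" "E d a" "\<not> E a c" "\<not> E b d" "a \<noteq> c" "b \<noteq> d"
  shows False
proof -
  have "a \<in> V" "b \<in> V" "c \<in> V" "d \<in> V"
    using assms edge_in_V by blast+
  moreover have "a \<noteq> b" "b \<noteq> c" "c \<noteq> d" "d \<noteq> a" using assms irrefl by auto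
  moreover have "E b a" "E c b" "E d c" "E a d" "\<not> E c a" "\<not> E d b" using assms sym by blast+
  ultimately have "has_induced_cycle V E 4"
    unfolding has_induced_cycle_def using assms irrefl
    by (intro exI[of _ "[a, b, c, d]"]) (simp add: all_less_4)
  then show False using no_cycles by blast
qed

lemma no_C6:
  assumes "E a b" "E b c" "E c d" "E d e" "E e f" "E f a"
    and "\<not> E a c" "\<not> E a d" "\<not> E a e" "\<not> E b d" "\<not> E b e" "\<not> E b f" "\<not> E c e" "\<not> E c f" "\<not> E d f"
    and "distinct [a, b, c, d, e, f]"
  shows False
proof -
  have "a \<in> V" "b \<in> V" "c \<in> V" "d \<in> V" "e \<in> V" "f \<in> V"
    using assms(1-6) edge_in_V by blast+
  moreover have "E b a" "E c b" "E d c" "E e d" "E f e" "E a f"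
    "\<not> E c a" "\<not> E d a" "\<not> E e a" "\<not> E d b" "\<not> E e b" "\<not> E f b" "\<not> E e c" "\<not> E f c" "\<not> E f d"
    using assms(1-15) sym by blast+
  ultimately have "has_induced_cycle V E 6"
    unfolding has_induced_cycle_def using assms irrefl
    by (intro exI[of _ "[a, b, c, d, e, f]"]) (simp add: all_less_6)
  then show False using no_cycles by blast
qed

section \<open>Edges between the two sides \<open>Q2 \<union> R2\<close> and
  \<open>Q3 \<union> R3\<close>\<close>

text \<open>With \<open>q1\<close> in \<open>Q1\<close> and \<open>q4\<close> in \<open>Q4\<close>,
  a common neighbour \<open>y\<close> of \<open>a\<close> and \<open>a'\<close> would close the
  induced 4-cycle \<open>q1 a y a'\<close>, and without the edge from \<open>b\<close> to
  \<open>b'\<close> the vertices \<open>q1 a b q4 b' a'\<close> would form an induced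
  6-cycle.\<close>

lemma nonadjacent_neighbourhoods:
  assumes a: "a \<in> Q2 \<union> R2" "a' \<in> Q2 \<union> R2" "a \<noteq> a'" "\<not> E a a'"
    and b: "b \<in> Q3 \<union> R3" "b' \<in> Q3 \<union> R3" "E a b" "E a' b'"
  shows "\<not> E a' b" and "b \<noteq> b'" and "E b b'"
proof -
  obtain q1 q4 where q: "q1 \<in> Q1" "q4 \<in> Q4" using nonempty by auto
  have qE: "E q1 a" "E q1 a'" "E q4 b" "E q4 b'" using adj q a b by auto
  have qN: "\<not> E q1 b" "\<not> E q1 b'" "\<not> E q4 a" "\<not> E q4 a'" "\<not> E q1 q4" using nonadj q a b by auto
  have neq: "q1 \<noteq> b" "q1 \<noteq> b'" "q4 \<noteq> a" "q4 \<noteq> a'" "q1 \<noteq> q4" "a \<noteq> b'" "a' \<noteq> b"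
    using disjoint(2,3,6-8,11,12,14,17,18,21) q a b by auto
  have disj: "\<not> E a' y" if "E a y" "y \<in> {b, b'}" for y
    using no_C4[of q1 a y a'] that qE qN neq a sym by blast
  show 1: "\<not> E a' b" using disj b by blast
  then show 2: "b \<noteq> b'" using b by blast
  have 3: "\<not> E a b'" using disj b by blast
  show "E b b'"
  proof (rule ccontr)
    assume "\<not> E b b'"
    then show False
      using no_C6[of q1 a b q4 b' a'] qE qN neq a b 1 2 3 sym by auto
  qed
qed

lemma nonadjacent_in_R3:
  assumes "u \<in> Q3 \<union> R3" "v \<in> Q3 \<union> R3" "u \<noteq> v" "\<not> E u v"
  shows "u \<in> R3" "v \<in> R3"
  using assms clique(3)[of u v] adj(4)[of u v] adj(4)[of v u] sym by blast+

lemma Q2_universal: "q \<in> Q2 \<Longrightarrow> a \<in> Q2 \<union> R2 \<Longrightarrow> a \<noteq> q \<Longrightarrow> E q a"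
  using clique(2) adj(3) by blast

text \<open>The crucial point: the neighbour of \<open>q\<close> in \<open>Q\<^sub>3 \<union> R\<^sub>3\<close> would otherwise be a nonneighbour of
  \<open>x\<close> in \<open>R\<^sub>3\<close>, and the mirror image of the argument applied to \<open>Q\<^sub>3\<close> contradicts that
  \<open>q\<close> is adjacent to all of \<open>Q\<^sub>2 \<union> R\<^sub>2\<close>.\<close>
lemma Q2_complete_to_nbhd_R2:
  assumes q: "q \<in> Q2" and r: "r \<in> R2" and x: "x \<in> Q3 \<union> R3" "E r x"
  shows "E q x"
proof (rule ccontr)
  assume nqx: "\<not> E q x"
  interpret sw: belt_graph V E Q4 Q3 Q2 Q1 Q5 R3 R2 by (rule swap)
  obtain r' where r': "r' \<in> R2" "r' \<noteq> r" "\<not> E r r'" using nonneighbour r by blast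
  obtain x' where x': "x' \<in> Q3 \<union> R3" "E r' x'" using cross_neighbour[of r'] r' by blast
  have rr: "\<not> E r' x" "x \<noteq> x'" "E x x'" "\<not> E r x'"
    using nonadjacent_neighbourhoods[of r r' x x'] nonadjacent_neighbourhoods[of r' r x' x]
      r r' x x' sym by blast+
  have qr: "E q r" "E q r'" using adj q r r' by auto
  have AB: "q \<noteq> y" "y \<noteq> r" "r \<noteq> y" "y \<noteq> r'" "r' \<noteq> y" if "y \<in> Q3 \<union> R3" for y
    using disjoint(7,11,14,21) that q r r' by auto
  have nqx': "\<not> E q x'"
    using no_C4[of q x' x r] qr rr x x' nqx AB[OF x(1)] AB[OF x'(1)] sym by blast
  \<comment> \<open>\<open>b\<close> turns out to be adjacent to none of \<open>r\<close>,
    \<open>r'\<close>, \<open>x\<close>, \<open>x'\<close>, since any such edge yields an induced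
    4-cycle through \<open>q\<close>. The nonedges to \<open>x\<close> and \<open>x'\<close> then
    put all three of \<open>b\<close>, \<open>x\<close>, \<open>x'\<close> into
    \<open>R3\<close>.\<close>
  obtain b where b: "b \<in> Q3 \<union> R3" "E q b" using cross_neighbour[of q] q by blast
  have bne: "b \<noteq> x" "b \<noteq> x'" using b nqx nqx' by auto
  have nrb: "\<not> E r b"
  proof
    assume "E r b"
    then have "\<not> E r' b" "E b x'"
      using nonadjacent_neighbourhoods[of r r' b x'] b r r' x' by blast+
    then show False using no_C4[of q b x' r'] qr b x' nqx' AB[OF b(1)] AB[OF x'(1)] sym by blast
  qed
  have nrb': "\<not> E r' b"
  proof
    assume "E r' b"
    then have "\<not> E r b" "E b x"
      using nonadjacent_neighbourhoods[of r' r b x] b r r' x sym by blast+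
    then show False using no_C4[of q b x r] qr b x nqx AB[OF b(1)] AB[OF x(1)] sym by blast
  qed
  have nbx: "\<not> E b x" "\<not> E b x'"
    using no_C4[of q b x r] no_C4[of q b x' r'] nqx nqx' nrb nrb' b qr x x'
      AB[OF b(1)] AB[OF x(1)] AB[OF x'(1)] sym by blast+
  have R3: "b \<in> R3" "x \<in> R3" "x' \<in> R3"
    using nonadjacent_in_R3[of b x] nonadjacent_in_R3[of b x'] nbx bne b x x' by blast+
  obtain p where p: "p \<in> Q3" using nonempty by auto
  have pE: "E p b" "E p x" "E p x'" using adj(4)[OF p] R3 by auto
  have neq: "p \<noteq> q" "p \<noteq> r" "p \<noteq> r'" "q \<noteq> x" "q \<noteq> x'" "r \<noteq> b" using disjoint(7,10,11,14,21) p q r r' R3 by auto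
  \<comment> \<open>If \<open>p\<close> and \<open>q\<close> were adjacent, the 4-cycles
    \<open>p q r x\<close> and \<open>p q r' x'\<close> would force edges from \<open>p\<close> to
    both \<open>r\<close> and \<open>r'\<close>, but these two are nonadjacent and have no common
    neighbour there.\<close>
  have npq: "\<not> E p q"
  proof
    assume pq: "E p q"
    have "E p r" using no_C4[of p q r x] pq qr x pE nqx neq sym by blast
    moreover have "E p r'" using no_C4[of p q r' x'] pq qr x' pE nqx' neq sym by blast
    ultimately show False
      using nonadjacent_neighbourhoods(1)[of r r' p x'] r r' p x' sym by blast
  qed
  have npr: "\<not> E p r" using no_C4[of p r q b] qr b pE npq nrb neq sym by blast
  \<comment> \<open>This neighbour of \<open>p\<close> is adjacent to \<open>q\<close> but not to
    \<open>b\<close>, so \<open>p a q b\<close> is the induced 4-cycle that ends the proof.\<close>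
  obtain a where a: "a \<in> Q2 \<union> R2" "E p a" using sw.cross_neighbour[of p] p by blast
  have "a \<noteq> q" using a npq by auto
  then have qa: "E q a" using Q2_universal q a by blast
  have ab: "a \<noteq> b" "a \<noteq> x" using disjoint(11,21) a(1) R3 by auto
  have nab: "\<not> E b a"
  proof
    assume ba: "E b a"
    have "E x r" using x(2) sym by blast
    then have "E a r" "\<not> E x a"
      using sw.nonadjacent_neighbourhoods(1,3)[OF _ _ bne(1) nbx(1) _ _ ba] R3 a(1) r by auto
    then show False using no_C4[of p a r x] a(2) x pE npr neq ab sym by blast
  qed
  show False using no_C4[of p a q b] a(2) qa b pE npq nab neq ab sym by blast
qed

text \<open>A nonneighbour \<open>t\<close> of \<open>s\<close> in \<open>R3\<close> has no common
  neighbour with \<open>s\<close> in \<open>Q2 \<union> R2\<close>. Yet by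
  \<open>Q2_complete_to_nbhd_R2\<close> a neighbour \<open>a\<close> of \<open>t\<close> is also
  adjacent to \<open>s\<close> if it lies in \<open>Q2\<close>, and if it lies in \<open>R2\<close>,
  any vertex of \<open>Q2\<close> is adjacent to both \<open>s\<close> and \<open>t\<close>.\<close>

lemma R2_R3_nonadjacent:
  assumes r: "r \<in> R2" and s: "s \<in> R3"
  shows "\<not> E r s"
proof
  assume rs: "E r s"
  interpret sw: belt_graph V E Q4 Q3 Q2 Q1 Q5 R3 R2 by (rule swap)
  obtain t where t: "t \<in> R3" "t \<noteq> s" "\<not> E s t" using sw.nonneighbour s by blast
  obtain a where a: "a \<in> Q2 \<union> R2" "E t a" using sw.cross_neighbour t by blast
  obtain q where q: "q \<in> Q2" using nonempty by auto
  have dis: "\<not> (E s u \<and> E t u)" if "u \<in> Q2 \<union> R2" for u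
    using sw.nonadjacent_neighbourhoods(1)[of s t u a] s t a that by blast
  show False
  proof (cases "a \<in> Q2")
    case True
    then show False using Q2_complete_to_nbhd_R2[OF True r, of s] rs s a dis[of a] sym by blast
  next
    case False
    then have "a \<in> R2" using a by blast
    then have "E q t" using Q2_complete_to_nbhd_R2[OF q, of a t] t a(2) sym by blast
    moreover have "E q s" using Q2_complete_to_nbhd_R2[OF q r _ rs] s by blast
    ultimately show False using dis[of q] q sym by blast
  qed
qed

section \<open>The laminar family of neighbourhoods of \<open>R2\<close> in
  \<open>Q3\<close>\<close>

text \<open>For \<open>r\<close> in \<open>R2\<close> this is the whole neighbourhood in
  \<open>Q3 \<union> R3\<close>, by \<open>R2_R3_nonadjacent\<close>.\<close>

definition N :: "'a \<Rightarrow> 'a set" where "N r = {x \<in> Q3. E r x}"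

text \<open>For \<open>r \<in> R\<^sub>2\<close>, \<open>up r\<close> is a clique containing \<open>r\<close> and every neighbour of \<open>r\<close> in \<open>R\<^sub>2\<close> that the
  greedy colouring treats before \<open>r\<close> (ties included).\<close>
definition up :: "'a \<Rightarrow> 'a set" where "up r = {r' \<in> R2. N r \<subseteq> N r'}"

lemma N_nonempty: "r \<in> R2 \<Longrightarrow> N r \<noteq> {}"
  using cross_neighbour[of r] R2_R3_nonadjacent unfolding N_def by blast

lemma N_subset: "N r \<subseteq> Q3" unfolding N_def by blast

lemma fin_N: "finite (N r)" using N_subset fin finite_subset by blast

lemma N_disjoint:
  "r \<in> R2 \<Longrightarrow> r' \<in> R2 \<Longrightarrow> r \<noteq> r' \<Longrightarrow> \<not> E r r' \<Longrightarrow> N r \<inter> N r' = {}"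
  using nonadjacent_neighbourhoods(1)[of r r'] unfolding N_def by blast

text \<open>Since \<open>x\<close> and \<open>x'\<close> are adjacent in the clique
  \<open>Q3\<close>, incomparable neighbourhoods would give the induced 4-cycle
  \<open>a x x' a'\<close>. Admitting vertices of \<open>Q2\<close> also yields the nestedness
  required by \<open>nested_nonedge_matching\<close>.\<close>

lemma nested_neighbourhoods:
  assumes "a \<in> Q2 \<union> R2" "a' \<in> Q2 \<union> R2" "E a a'" "x \<in> Q3" "x' \<in> Q3" "E a x" "\<not> E a' x" "E a' x'"
  shows "E a x'"
proof (rule ccontr)
  assume "\<not> E a x'"
  then show False
    using no_C4[of a x x' a'] assms clique(3)[of x x'] sym disjoint(7,14) by blast
qed

lemma N_nested: "r \<in> R2 \<Longrightarrow> r' \<in> R2 \<Longrightarrow> E r r' \<Longrightarrow> N r \<subseteq> N r' \<or> N r' \<subseteq> N r"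
  using nested_neighbourhoods[of r r'] unfolding N_def by blast

lemma N_laminar:
  "r \<in> R2 \<Longrightarrow> r' \<in> R2 \<Longrightarrow> N r \<inter> N r' = {} \<or> N r \<subseteq> N r' \<or> N r' \<subseteq> N r"
  using N_disjoint N_nested by blast

text \<open>The neighbourhoods of members of \<open>up r\<close> all contain the non-empty set
  \<open>N r\<close>, whereas nonadjacent vertices of \<open>R2\<close> have disjoint ones.\<close>

lemma up_clique:
  assumes "r \<in> R2" "u \<in> up r" "v \<in> up r" "u \<noteq> v"
  shows "E u v"
  using N_nonempty[OF assms(1)] assms N_disjoint[of u v] unfolding up_def by blast

lemma clique_Q1_Q5: "is_clique E (Q1 \<union> Q5)"
  unfolding is_clique_def using clique(1,5) adj(1) sym by (metis Un_iff)

lemma clique_Q1_Q2: "is_clique E (Q1 \<union> Q2)"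
  unfolding is_clique_def using clique(1,2) adj(1) sym by (metis Un_iff)

lemma clique_Q1_Q2_up: "r \<in> R2 \<Longrightarrow> is_clique E (Q1 \<union> Q2 \<union> up r)"
proof -
  assume r: "r \<in> R2"
  have "u \<in> R2" if "u \<in> up r" for u using that unfolding up_def by blast
  then show ?thesis unfolding is_clique_def
    using clique(1,2) adj(1,3) sym up_clique[OF r] by (metis Un_iff)
qed

lemma Q2_N_adjacent: "r \<in> R2 \<Longrightarrow> q \<in> Q2 \<Longrightarrow> x \<in> N r \<Longrightarrow> E q x"
  using Q2_complete_to_nbhd_R2[of q r x] unfolding N_def by blast

lemma clique_up_Q2_N:
  assumes r: "r \<in> R2"
  shows "is_clique E (up r \<union> Q2 \<union> N r)"
proof -
  have a: "u \<in> up r \<Longrightarrow> u \<in> R2" "u \<in> up r \<Longrightarrow> x \<in> N r \<Longrightarrow> E u x" "x \<in> N r \<Longrightarrow> x \<in> Q3" for u x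
    unfolding up_def N_def by blast+
  show ?thesis unfolding is_clique_def
    using a clique(2,3) adj(3) sym up_clique[OF r] Q2_N_adjacent[OF r] by (metis Un_iff)
qed

lemma parts_subset: "Q1 \<subseteq> V" "Q2 \<subseteq> V" "Q5 \<subseteq> V" "R2 \<subseteq> V"
  using V_eq by blast+

section \<open>Clique bounds and the vertices that reuse colours of \<open>Q1\<close>\<close>

lemma clique_sizes:
  assumes w: "\<forall>K. K \<subseteq> V \<longrightarrow> is_clique E K \<longrightarrow> card K \<le> w"
  shows "card Q1 + card Q5 \<le> w" and "card Q1 + card Q2 \<le> w"
  using w[rule_format, of "Q1 \<union> Q5"] w[rule_format, of "Q1 \<union> Q2"] clique_Q1_Q5 clique_Q1_Q2 parts_subset
    card_Un_disjoint[OF fin(1) fin(5) disjoint(4)] card_Un_disjoint[OF fin(1) fin(2) disjoint(1)]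
  by auto

text \<open>Truncated subtraction: \<open>|Q\<^sub>1| + |Q\<^sub>4| + |Q\<^sub>5| - k\<close> is the number \<open>o\<close> of colours that \<open>Q\<^sub>1\<close> and \<open>Q\<^sub>4\<close>
  must share.\<close>
lemma small_transversal:
  assumes w: "\<forall>K. K \<subseteq> V \<longrightarrow> is_clique E K \<longrightarrow> card K \<le> w" and k: "5 * w \<le> 4 * k"
  shows "\<exists>Z\<subseteq>Q3. (\<forall>q\<in>Q2. \<forall>z\<in>Z. E q z) \<and>
    card Z + (card Q1 + card Q4 + card Q5 - k) \<le> card Q1 \<and>
    (\<forall>r\<in>R2. card (up r) + card Q1 + card Q2 + card (N r - Z) \<le> k)"
proof -
  interpret sw: belt_graph V E Q4 Q3 Q2 Q1 Q5 R3 R2 by (rule swap)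
  let ?X = "\<Union>(N ` R2)"
  let ?o = "card Q1 + card Q4 + card Q5 - k"
  have fin_up: "finite (up r)" for r unfolding up_def using fin by simp
  have X: "?X \<subseteq> Q3" using N_subset by blast
  have finX: "finite ?X" using fin(3) X finite_subset by blast
  note q = clique_sizes[OF w] sw.clique_sizes[OF w]
  have X4: "card ?X + card Q4 \<le> w" using card_mono[OF fin(3) X] q by simp
  have up: "card Q1 + card Q2 + card (up r) \<le> w" if r: "r \<in> R2" for r
  proof -
    have "card (Q1 \<union> Q2 \<union> up r) \<le> w"
      by (rule w[rule_format]) (use clique_Q1_Q2_up r in_V in \<open>auto simp: up_def\<close>)
    moreover have "(Q1 \<union> Q2) \<inter> up r = {}" using disjoint(5,10) unfolding up_def by blast
    ultimately show ?thesis
      using card_Un_disjoint[of "Q1 \<union> Q2" "up r"] card_Un_disjoint[of Q1 Q2] disjoint(1) fin fin_up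
      by simp
  qed
  have upN: "card (up r) + card Q2 + card (N r) \<le> w" if r: "r \<in> R2" for r
  proof -
    have "card (up r \<union> Q2 \<union> N r) \<le> w"
      by (rule w[rule_format]) (use clique_up_Q2_N r in_V in \<open>auto simp: up_def N_def\<close>)
    moreover have "up r \<inter> Q2 = {}" "(up r \<union> Q2) \<inter> N r = {}"
      using disjoint(7,10,14) unfolding up_def N_def by blast+
    ultimately show ?thesis
      using card_Un_disjoint[of "up r \<union> Q2" "N r"] card_Un_disjoint[of "up r" Q2] fin fin_up fin_N
      by simp
  qed
  have NX: "card (N r) \<le> card ?X" if "r \<in> R2" for r
    by (rule card_mono) (use finX that in auto)
  have "\<exists>Z\<subseteq>?X. card Z \<le> card Q1 - ?o \<and>
      (\<forall>r\<in>R2. card (N r - Z) \<le> k - card (up r) - card Q1 - card Q2)"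
  \<comment> \<open>The capacity of \<open>r\<close> is what remains of \<open>k\<close> colours
    after \<open>up r\<close>, \<open>Q1\<close> and \<open>Q2\<close>; it is at least the slack
    \<open>k - w\<close> because these three sets form a clique. The bound on \<open>card Z\<close>
    is the number of colours on \<open>Q1\<close> but not on \<open>Q4\<close>.\<close>
  proof (rule laminar_small_transversal[where X = ?X and s = "k - w"])
    show "finite ?X" by (rule finX)
    show "N r \<subseteq> ?X" if "r \<in> R2" for r using that by blast
    show "N r \<inter> N r' = {} \<or> N r \<subseteq> N r' \<or> N r' \<subseteq> N r" if "r \<in> R2" "r' \<in> R2" for r r'
      using N_laminar that by blast
    show "k - w \<le> k - card (up r) - card Q1 - card Q2" if "r \<in> R2" for r
      using up[OF that] by linarith
    \<comment> \<open>For \<open>?o > 0\<close> this says that \<open>N r\<close>,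
      \<open>up r\<close>, \<open>Q1\<close>, \<open>Q2\<close>, \<open>Q4\<close>,
      \<open>Q5\<close> have total size at most \<open>2 * k\<close>. Pairs of cliques bound the
      total by \<open>2 * w + card Q1\<close> and by \<open>2 * w + card Q5\<close>; as
      \<open>Q1 \<union> Q5\<close> is a clique, the average of these is at most
      \<open>5 * w / 2\<close>.\<close>
    show "card (N r) \<le> k - card (up r) - card Q1 - card Q2 + (card Q1 - ?o)" if "r \<in> R2" for r
      using up[OF that] upN[OF that] q X4 NX[OF that] k by linarith
    show "card ?X \<le> 4 * (k - w)" using X4 k by linarith
    show "(\<forall>r\<in>R2. card (N r) + (k - w) \<le> k - card (up r) - card Q1 - card Q2 + (card Q1 - ?o)) \<or>
        card ?X \<le> card Q1 - ?o + 2 * (k - w)"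
    \<comment> \<open>If nothing is shared, the clique on \<open>up r\<close>, \<open>Q2\<close>,
      \<open>N r\<close> gives the first alternative. Otherwise
      \<open>card Q1 > k - w \<ge> w / 4\<close>, so \<open>card Q5 < 3 * w / 4\<close>, and
      \<open>card ?X + card Q4 \<le> w\<close> gives the second.\<close>
    proof (cases "?o = 0")
      case True
      have "card (N r) + (k - w) \<le> k - card (up r) - card Q1 - card Q2 + (card Q1 - ?o)"
        if "r \<in> R2" for r
        using up[OF that] upN[OF that] True k by linarith
      then show ?thesis by blast
    next
      case False
      then have "card ?X \<le> card Q1 - ?o + 2 * (k - w)"
        using q X4 k by linarith
      then show ?thesis by blast
    qed
  qed
  then obtain Z where Z: "Z \<subseteq> ?X" "card Z \<le> card Q1 - ?o"
    "\<forall>r\<in>R2. card (N r - Z) \<le> k - card (up r) - card Q1 - card Q2" by blast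
  have "?o \<le> card Q1" using q k by linarith
  then have "card Z + ?o \<le> card Q1" using Z(2) by linarith
  moreover have "card (up r) + card Q1 + card Q2 + card (N r - Z) \<le> k" if "r \<in> R2" for r
    using Z(3) up[OF that] k that by fastforce
  moreover have "\<forall>q\<in>Q2. \<forall>z\<in>Z. E q z" using Z(1) Q2_N_adjacent by blast
  moreover have "Z \<subseteq> Q3" using Z(1) X by (rule order_trans)
  ultimately show ?thesis by (intro exI[of _ Z] conjI ballI) simp_all
qed

section \<open>Construction of the colouring\<close>

text \<open>The greedy colouring is applied with lists that omit only the colours of
  \<open>Q1\<close>, \<open>Q2\<close> and \<open>N r - Z\<close>, since those of \<open>Z\<close>
  already occur on \<open>Q1\<close>. The neighbours coloured before \<open>r\<close> lie in
  \<open>up r - {r}\<close>, so a colour is left.\<close>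

lemma colour_R2:
  fixes F :: "'a \<Rightarrow> nat"
  assumes "F ` Z \<subseteq> F ` Q1"
    and "\<And>r. r \<in> R2 \<Longrightarrow> card (up r) + card Q1 + card Q2 + card (N r - Z) \<le> k"
  shows "\<exists>g. \<forall>r\<in>R2. g r < k \<and> g r \<notin> F ` Q1 \<and> g r \<notin> F ` Q2 \<and> (\<forall>x\<in>N r. g r \<noteq> F x) \<and>
    (\<forall>r'\<in>R2. E r r' \<longrightarrow> g r \<noteq> g r')"
proof -
  define L where "L = (\<lambda>r. {..<k} - (F ` Q1 \<union> F ` Q2 \<union> F ` (N r - Z)))"
  have "\<exists>g. (\<forall>r\<in>R2. g r \<in> L r) \<and> (\<forall>u\<in>R2. \<forall>v\<in>R2. u \<noteq> v \<longrightarrow> E u v \<longrightarrow> g u \<noteq> g v)"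
  proof (rule greedy_list_colouring[where m = "\<lambda>r. card (N r)"])
    show "finite R2" by (rule fin)
    show "finite (L r)" for r unfolding L_def by simp
    show "E u v \<Longrightarrow> E v u" for u v by (rule sym)
    fix r assume r: "r \<in> R2"
    let ?B = "{r' \<in> R2. r' \<noteq> r \<and> E r r' \<and> card (N r) \<le> card (N r')}"
    \<comment> \<open>Adjacent vertices have nested sets, and in the case of a tie in size these are
      equal.\<close>
    have "N r \<subseteq> N r'" if "r' \<in> ?B" for r'
    proof -
      have "N r \<subseteq> N r' \<or> N r' \<subseteq> N r" using N_nested[of r r'] r that by blast
      moreover have "N r' = N r" if "N r' \<subseteq> N r"
        by (rule card_seteq[OF fin_N that]) (use \<open>r' \<in> ?B\<close> in blast)
      ultimately show ?thesis by blast
    qed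
    then have "?B \<subseteq> up r - {r}" unfolding up_def by blast
    moreover have "r \<in> up r" "finite (up r)" using r fin unfolding up_def by auto
    ultimately have B: "card ?B < card (up r)" by (intro psubset_card_mono) blast+
    have "card (F ` Q1 \<union> F ` Q2 \<union> F ` (N r - Z)) \<le> card (F ` Q1) + card (F ` Q2) + card (F ` (N r - Z))"
      using card_Un_le[of "F ` Q1 \<union> F ` Q2" "F ` (N r - Z)"] card_Un_le[of "F ` Q1" "F ` Q2"] by linarith
    also have "\<dots> \<le> card Q1 + card Q2 + card (N r - Z)"
      using card_image_le[of Q1 F] card_image_le[of Q2 F] card_image_le[of "N r - Z" F] fin fin_N
      by (meson add_mono finite_Diff)
    finally have "k - (card Q1 + card Q2 + card (N r - Z)) \<le> card (L r)"
      using diff_card_le_card_Diff[of "F ` Q1 \<union> F ` Q2 \<union> F ` (N r - Z)" "{..<k}"] fin fin_N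
      unfolding L_def by simp
    then show "card ?B < card (L r)" using B assms(2)[OF r] by linarith
  qed
  then obtain g where g: "\<forall>r\<in>R2. g r \<in> L r"
    "\<forall>u\<in>R2. \<forall>v\<in>R2. u \<noteq> v \<longrightarrow> E u v \<longrightarrow> g u \<noteq> g v" by blast
  have "g r \<noteq> F x" if "r \<in> R2" "x \<in> N r" for r x
  proof (cases "x \<in> Z")
    case True
    then have "F x \<in> F ` Q1" using assms(1) by blast
    then show ?thesis using g(1) that(1) unfolding L_def by auto
  next
    case False
    then show ?thesis using g(1) that unfolding L_def by blast
  qed
  moreover have "g r < k \<and> g r \<notin> F ` Q1 \<and> g r \<notin> F ` Q2" if "r \<in> R2" for r
    using g(1) that unfolding L_def by blast
  ultimately show ?thesis using g(2) irrefl by metis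
qed

text \<open>Placing \<open>Z\<close> on colours of \<open>Q1\<close> and \<open>W\<close> on colours
  of \<open>Q4\<close> prepares for \<open>colour_R2\<close>: these colours are excluded for
  \<open>R2\<close> and \<open>R3\<close>, respectively, anyway.\<close>

lemma colour_cliques:
  assumes w: "\<forall>K. K \<subseteq> V \<longrightarrow> is_clique E K \<longrightarrow> card K \<le> w" and k: "5 * w \<le> 4 * k"
    and Z: "Z \<subseteq> Q3" "\<forall>q\<in>Q2. \<forall>z\<in>Z. E q z" "card Z + (card Q1 + card Q4 + card Q5 - k) \<le> card Q1"
    and W: "W \<subseteq> Q2" "\<forall>q\<in>Q3. \<forall>z\<in>W. E q z" "card W + (card Q4 + card Q1 + card Q5 - k) \<le> card Q4"
  shows "\<exists>c1 c2 c3 c4 c5. inj_on c1 Q1 \<and> inj_on c2 Q2 \<and> inj_on c3 Q3 \<and> inj_on c4 Q4 \<and> inj_on c5 Q5 \<and>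
    c1 ` Q1 \<union> c2 ` Q2 \<union> c3 ` Q3 \<union> c4 ` Q4 \<union> c5 ` Q5 \<subseteq> {..<(k::nat)} \<and>
    c1 ` Q1 \<inter> c2 ` Q2 = {} \<and> c1 ` Q1 \<inter> c5 ` Q5 = {} \<and> c4 ` Q4 \<inter> c3 ` Q3 = {} \<and> c4 ` Q4 \<inter> c5 ` Q5 = {} \<and>
    (\<forall>a\<in>Q2. \<forall>b\<in>Q3. E a b \<longrightarrow> c2 a \<noteq> c3 b) \<and> c3 ` Z \<subseteq> c1 ` Q1 \<and> c2 ` W \<subseteq> c4 ` Q4"
proof -
  interpret sw: belt_graph V E Q4 Q3 Q2 Q1 Q5 R3 R2 by (rule swap)
  let ?o = "card Q1 + card Q4 + card Q5 - k"
  \<comment> \<open>The \<open>?o\<close> colours on both \<open>Q1\<close> and \<open>Q4\<close>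
    are forbidden for \<open>Q2\<close> and for \<open>Q3\<close>, so these two have
    \<open>k - ?o\<close> colours between them and must share the excess.\<close>
  let ?j = "card Q2 + card Q3 + ?o - k"
  note q = clique_sizes[OF w] sw.clique_sizes[OF w]
  have "\<exists>S p. S \<subseteq> Q2 \<and> inj_on p S \<and> p ` S \<subseteq> Q3 \<and> (\<forall>a\<in>S. \<not> E a (p a)) \<and>
      card Q2 + card Q3 \<le> w + card S"
  proof (rule nested_nonedge_matching)
    show "finite Q2" "finite Q3" by (rule fin)+
    show "(\<forall>b\<in>Q3. E a b \<longrightarrow> E a' b) \<or> (\<forall>b\<in>Q3. E a' b \<longrightarrow> E a b)" if "a \<in> Q2" "a' \<in> Q2" for a a'
      using nested_neighbourhoods[of a a'] clique(2)[of a a'] that by blast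
    fix A' B' assume h: "A' \<subseteq> Q2" "B' \<subseteq> Q3" "complete_to E A' B'"
    have "is_clique E (A' \<union> B')"
      using h clique(2,3) sym unfolding is_clique_def complete_to_def by (metis Un_iff subsetD)
    moreover have "A' \<union> B' \<subseteq> V" using h in_V by blast
    moreover have "card (A' \<union> B') = card A' + card B'"
      by (rule card_Un_disjoint) (use h fin disjoint(7) finite_subset in blast)+
    ultimately show "card A' + card B' \<le> w" using w by metis
  qed
  then obtain S0 p where S0: "S0 \<subseteq> Q2" "inj_on p S0" "p ` S0 \<subseteq> Q3" "\<forall>a\<in>S0. \<not> E a (p a)"
    "card Q2 + card Q3 \<le> w + card S0" by blast
  \<comment> \<open>Only \<open>?o > 0\<close> is delicate. If \<open>card Q5 \<le> w / 2\<close>,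
    all five cliques together have at most \<open>5 * w / 2 \<le> 2 * k\<close> vertices and
    \<open>?j = 0\<close>. Otherwise \<open>card Q1\<close> and \<open>card Q4\<close> are at most
    \<open>w - card Q5\<close>, hence \<open>?o \<le> k - w\<close>.\<close>
  have "?j \<le> card S0" using S0(5) q k by linarith
  then obtain S where S: "S \<subseteq> S0" "card S = ?j" using obtain_subset_with_card_n by metis
  have S': "S \<subseteq> Q2" "inj_on p S" "p ` S \<subseteq> Q3" "\<forall>a\<in>S. \<not> E a (p a)"
    using S(1) S0 by (auto intro: inj_on_subset)
  \<comment> \<open>Vertices complete to the other side belong to no nonadjacent pair.\<close>
  have Wsub: "W \<subseteq> Q2 - S" using W S' sym by blast
  have Zsub: "Z \<subseteq> Q3 - p ` S" using Z S' by blast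
  \<comment> \<open>The intervals for \<open>Q1\<close> and \<open>Q4\<close> overlap in exactly
    \<open>?o\<close> colours; \<open>D\<close> and \<open>D'\<close> are the colours on only
    \<open>Q1\<close> and only \<open>Q4\<close>, and \<open>G\<close> those on neither.
    \<open>C5\<close> lies inside \<open>G\<close>, and \<open>Q2\<close> and \<open>Q3\<close> may
    reuse it because \<open>Q5\<close> is anticomplete to them.\<close>
  define C1 C4 where "C1 = {..<card Q1}" and "C4 = {card Q1 - ?o..<card Q1 - ?o + card Q4}"
  define C5 where "C5 = {k - card Q5..<k}"
  define D where "D = {..<card Q1 - ?o}"
  define D' where "D' = {card Q1..<card Q1 - ?o + card Q4}"
  define G where "G = {card Q1 - ?o + card Q4..<k}"
  note defs = C1_def C4_def C5_def D_def D'_def G_def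
  have o: "?o \<le> card Q1" "?o \<le> card Q4" "card Q1 - ?o + card Q4 + card Q5 \<le> k"
    using q k by linarith+
  have fins: "finite C1" "finite C4" "finite C5" "finite D" "finite D'" "finite G"
    unfolding defs by simp_all
  have cards: "card C1 = card Q1" "card C4 = card Q4" "card C5 = card Q5"
    "card D = card Q1 - ?o" "card D' = card Q4 - ?o" "card G = k - (card Q1 - ?o + card Q4)"
    unfolding defs using o by simp_all
  have D_dis: "D \<inter> D' = {}" "D \<inter> G = {}" "D' \<inter> G = {}"
    unfolding defs by auto
  have C_dis: "C1 \<inter> (D' \<union> G) = {}" "C4 \<inter> (D \<union> G) = {}" "C1 \<inter> C5 = {}" "C4 \<inter> C5 = {}"
    unfolding defs using o by auto
  have D_sub: "D \<subseteq> C1" "D' \<subseteq> C4" unfolding defs by auto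
  have sub_k: "C1 \<subseteq> {..<k}" "C4 \<subseteq> {..<k}" "C5 \<subseteq> {..<k}" "D' \<union> G \<subseteq> {..<k}" "D \<union> G \<subseteq> {..<k}"
    unfolding defs using o by auto
  have cW: "card W \<le> card D'" unfolding cards using W(3) by (simp add: ac_simps)
  have cZ: "card Z \<le> card D" unfolding cards using Z(3) by simp
  have "?j + (card Q2 - ?j - (card Q4 - ?o)) + (card Q3 - ?j - (card Q1 - ?o))
      \<le> k - (card Q1 - ?o + card Q4)"
    using palette_arith[of "card Q1 - ?o" ?o "card Q2" k "card Q3" "card Q4 - ?o"] o q k by simp
  then have num: "card S + (card Q2 - card S - card D') + (card Q3 - card S - card D) \<le> card G"
    unfolding cards S(2) .
  from colour_two_cliques_sharing[OF fin(2,3) fins(4-6) D_dis S'(1-3) Wsub cW Zsub cZ num]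
  obtain f where "\<exists>g. inj_on f Q2 \<and> f ` Q2 \<subseteq> D' \<union> G \<and> f ` W \<subseteq> D' \<and>
      inj_on g Q3 \<and> g ` Q3 \<subseteq> D \<union> G \<and> g ` Z \<subseteq> D \<and>
      (\<forall>a\<in>Q2. \<forall>b\<in>Q3. f a = g b \<longrightarrow> a \<in> S \<and> b = p a)" ..
  then obtain g where fg: "inj_on f Q2 \<and> f ` Q2 \<subseteq> D' \<union> G \<and> f ` W \<subseteq> D' \<and>
      inj_on g Q3 \<and> g ` Q3 \<subseteq> D \<union> G \<and> g ` Z \<subseteq> D \<and>
      (\<forall>a\<in>Q2. \<forall>b\<in>Q3. f a = g b \<longrightarrow> a \<in> S \<and> b = p a)" ..
  have bij: "\<exists>c. inj_on c Q \<and> c ` Q = C" if "finite Q" "finite C" "card C = card Q"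
    for Q :: "'a set" and C :: "nat set"
    using finite_same_card_bij[of Q C] that unfolding bij_betw_def by auto
  obtain c1 where c1: "inj_on c1 Q1" "c1 ` Q1 = C1"
    using bij[OF fin(1) fins(1) cards(1)] by blast
  obtain c4 where c4: "inj_on c4 Q4" "c4 ` Q4 = C4"
    using bij[OF fin(4) fins(2) cards(2)] by blast
  obtain c5 where c5: "inj_on c5 Q5" "c5 ` Q5 = C5"
    using bij[OF fin(5) fins(3) cards(3)] by blast
  have "c1 ` Q1 \<union> f ` Q2 \<union> g ` Q3 \<union> c4 ` Q4 \<union> c5 ` Q5 \<subseteq> {..<k}"
  proof -
    have "f ` Q2 \<subseteq> {..<k}" "g ` Q3 \<subseteq> {..<k}" using fg sub_k(4,5) by (meson order_trans)+
    then show ?thesis unfolding c1 c4 c5 using sub_k(1-3) by (intro Un_least)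
  qed
  moreover have "c1 ` Q1 \<inter> f ` Q2 = {}" "c4 ` Q4 \<inter> g ` Q3 = {}"
  proof -
    have "f ` Q2 \<subseteq> D' \<union> G" "g ` Q3 \<subseteq> D \<union> G" using fg by simp_all
    then show "c1 ` Q1 \<inter> f ` Q2 = {}" "c4 ` Q4 \<inter> g ` Q3 = {}"
      unfolding c1 c4 using C_dis(1,2) by blast+
  qed
  moreover have "c1 ` Q1 \<inter> c5 ` Q5 = {}" "c4 ` Q4 \<inter> c5 ` Q5 = {}"
    unfolding c1 c4 c5 by (fact C_dis)+
  moreover have "g ` Z \<subseteq> c1 ` Q1" "f ` W \<subseteq> c4 ` Q4"
    unfolding c1 c4 using fg D_sub by (meson order_trans)+
  moreover have "\<forall>a\<in>Q2. \<forall>b\<in>Q3. E a b \<longrightarrow> f a \<noteq> g b"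
  proof (intro ballI impI notI)
    fix a b assume ab: "a \<in> Q2" "b \<in> Q3" "E a b" "f a = g b"
    then have "a \<in> S \<and> b = p a" using fg by simp
    then show False using S'(4) ab(3) by simp
  qed
  moreover have "inj_on f Q2" "inj_on g Q3" using fg by simp_all
  ultimately show ?thesis
    using c1(1) c4(1) c5(1)
    by (intro exI[of _ c1] exI[of _ f] exI[of _ g] exI[of _ c4] exI[of _ c5] conjI)
qed

text \<open>The colouring of the five cliques extends to \<open>R2\<close> and to \<open>R3\<close>
  independently, because no edge joins these two sets; \<open>R3\<close> is handled by the reflected
  instance of \<open>colour_R2\<close>.\<close>

lemma colourable:
  assumes w: "\<forall>K. K \<subseteq> V \<longrightarrow> is_clique E K \<longrightarrow> card K \<le> w" and k: "5 * w \<le> 4 * k"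
  shows "\<exists>f. proper_colouring V E k f"
proof -
  interpret sw: belt_graph V E Q4 Q3 Q2 Q1 Q5 R3 R2 by (rule swap)
  obtain Z where Z: "Z \<subseteq> Q3" "\<forall>q\<in>Q2. \<forall>z\<in>Z. E q z"
    "card Z + (card Q1 + card Q4 + card Q5 - k) \<le> card Q1"
    "\<forall>r\<in>R2. card (up r) + card Q1 + card Q2 + card (N r - Z) \<le> k"
    using small_transversal[OF w k] by blast
  obtain W where W: "W \<subseteq> Q2" "\<forall>q\<in>Q3. \<forall>z\<in>W. E q z"
    "card W + (card Q4 + card Q1 + card Q5 - k) \<le> card Q4"
    "\<forall>r\<in>R3. card (sw.up r) + card Q4 + card Q3 + card (sw.N r - W) \<le> k"
    using sw.small_transversal[OF w k] by blast
  obtain c1 c2 c3 c4 c5 where inj: "inj_on c1 Q1" "inj_on c2 Q2" "inj_on c3 Q3" "inj_on c4 Q4" "inj_on c5 Q5"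
    and lt: "c1 ` Q1 \<union> c2 ` Q2 \<union> c3 ` Q3 \<union> c4 ` Q4 \<union> c5 ` Q5 \<subseteq> {..<k}"
    and dis: "c1 ` Q1 \<inter> c2 ` Q2 = {}" "c1 ` Q1 \<inter> c5 ` Q5 = {}" "c4 ` Q4 \<inter> c3 ` Q3 = {}" "c4 ` Q4 \<inter> c5 ` Q5 = {}"
    and c23: "\<forall>a\<in>Q2. \<forall>b\<in>Q3. E a b \<longrightarrow> c2 a \<noteq> c3 b"
    and ZW: "c3 ` Z \<subseteq> c1 ` Q1" "c2 ` W \<subseteq> c4 ` Q4"
    using colour_cliques[OF w k Z(1-3) W(1-3)] by (elim exE conjE) (rule that)
  define F where "F = (\<lambda>v. if v \<in> Q1 then c1 v else if v \<in> Q2 then c2 v else if v \<in> Q3 then c3 v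
    else if v \<in> Q4 then c4 v else c5 v)"
  have F: "v \<in> Q1 \<Longrightarrow> F v = c1 v" "v \<in> Q2 \<Longrightarrow> F v = c2 v" "v \<in> Q3 \<Longrightarrow> F v = c3 v"
    "v \<in> Q4 \<Longrightarrow> F v = c4 v" "v \<in> Q5 \<Longrightarrow> F v = c5 v" for v
    using disjoint(1-4,7-9,12,13,16) by (auto simp: F_def)
  have img: "F ` Q1 = c1 ` Q1" "F ` Q2 = c2 ` Q2" "F ` Q3 = c3 ` Q3" "F ` Q4 = c4 ` Q4"
    using F by (auto cong: image_cong)
  have imgZ: "F ` Z \<subseteq> F ` Q1" "F ` W \<subseteq> F ` Q4"
    using F Z(1) W(1) ZW img by (auto simp: image_subset_iff subset_iff)
  from colour_R2[OF imgZ(1) Z(4)[rule_format]]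
  obtain g where g: "\<forall>r\<in>R2. g r < k \<and> g r \<notin> F ` Q1 \<and> g r \<notin> F ` Q2 \<and> (\<forall>x\<in>N r. g r \<noteq> F x) \<and>
      (\<forall>r'\<in>R2. E r r' \<longrightarrow> g r \<noteq> g r')" ..
  from sw.colour_R2[OF imgZ(2) W(4)[rule_format]]
  obtain h where h: "\<forall>r\<in>R3. h r < k \<and> h r \<notin> F ` Q4 \<and> h r \<notin> F ` Q3 \<and> (\<forall>x\<in>sw.N r. h r \<noteq> F x) \<and>
      (\<forall>r'\<in>R3. E r r' \<longrightarrow> h r \<noteq> h r')" ..
  define C where "C = (\<lambda>v. if v \<in> R2 then g v else if v \<in> R3 then h v else F v)"
  have C: "v \<in> Q1 \<Longrightarrow> C v = c1 v" "v \<in> Q2 \<Longrightarrow> C v = c2 v" "v \<in> Q3 \<Longrightarrow> C v = c3 v"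
    "v \<in> Q4 \<Longrightarrow> C v = c4 v" "v \<in> Q5 \<Longrightarrow> C v = c5 v" "v \<in> R2 \<Longrightarrow> C v = g v" "v \<in> R3 \<Longrightarrow> C v = h v" for v
    using disjoint(5,6,10,11,14,15,17-21) F by (auto simp: C_def)
  have dis1: "c1 x \<noteq> c2 y" if "x \<in> Q1" "y \<in> Q2" for x y using dis(1) that by blast
  have dis2: "c1 x \<noteq> c5 y" if "x \<in> Q1" "y \<in> Q5" for x y using dis(2) that by blast
  have dis3: "c4 x \<noteq> c3 y" if "x \<in> Q4" "y \<in> Q3" for x y using dis(3) that by blast
  have dis4: "c4 x \<noteq> c5 y" if "x \<in> Q4" "y \<in> Q5" for x y using dis(4) that by blast
  have g': "r \<in> R2 \<Longrightarrow> x \<in> Q1 \<Longrightarrow> g r \<noteq> c1 x" "r \<in> R2 \<Longrightarrow> x \<in> Q2 \<Longrightarrow> g r \<noteq> c2 x"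
    "r \<in> R2 \<Longrightarrow> x \<in> Q3 \<Longrightarrow> E r x \<Longrightarrow> g r \<noteq> c3 x" "r \<in> R2 \<Longrightarrow> x \<in> R2 \<Longrightarrow> E r x \<Longrightarrow> g r \<noteq> g x" for r x
  proof -
    show "g r \<noteq> c1 x" if "r \<in> R2" "x \<in> Q1" using g that img(1) by blast
    show "g r \<noteq> c2 x" if "r \<in> R2" "x \<in> Q2" using g that img(2) by blast
    show "g r \<noteq> c3 x" if "r \<in> R2" "x \<in> Q3" "E r x" using g that F(3)[of x] unfolding N_def by fastforce
    show "g r \<noteq> g x" if "r \<in> R2" "x \<in> R2" "E r x" using g that by blast
  qed
  have h': "r \<in> R3 \<Longrightarrow> x \<in> Q4 \<Longrightarrow> h r \<noteq> c4 x" "r \<in> R3 \<Longrightarrow> x \<in> Q3 \<Longrightarrow> h r \<noteq> c3 x"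
    "r \<in> R3 \<Longrightarrow> x \<in> Q2 \<Longrightarrow> E r x \<Longrightarrow> h r \<noteq> c2 x" "r \<in> R3 \<Longrightarrow> x \<in> R3 \<Longrightarrow> E r x \<Longrightarrow> h r \<noteq> h x" for r x
  proof -
    show "h r \<noteq> c4 x" if "r \<in> R3" "x \<in> Q4" using h that img(4) by blast
    show "h r \<noteq> c3 x" if "r \<in> R3" "x \<in> Q3" using h that img(3) by blast
    show "h r \<noteq> c2 x" if "r \<in> R3" "x \<in> Q2" "E r x" using h that F(2)[of x] unfolding sw.N_def by fastforce
    show "h r \<noteq> h x" if "r \<in> R3" "x \<in> R3" "E r x" using h that by blast
  qed
  have sameQ1: "C u \<noteq> C v" if "u \<in> Q1" "v \<in> Q1" "E u v" for u v
    using inj_onD[OF inj(1), of u v] C(1) that irrefl by metis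
  have sameQ2: "C u \<noteq> C v" if "u \<in> Q2" "v \<in> Q2" "E u v" for u v
    using inj_onD[OF inj(2), of u v] C(2) that irrefl by metis
  have sameQ3: "C u \<noteq> C v" if "u \<in> Q3" "v \<in> Q3" "E u v" for u v
    using inj_onD[OF inj(3), of u v] C(3) that irrefl by metis
  have sameQ4: "C u \<noteq> C v" if "u \<in> Q4" "v \<in> Q4" "E u v" for u v
    using inj_onD[OF inj(4), of u v] C(4) that irrefl by metis
  have sameQ5: "C u \<noteq> C v" if "u \<in> Q5" "v \<in> Q5" "E u v" for u v
    using inj_onD[OF inj(5), of u v] C(5) that irrefl by metis
  have row1: "C u \<noteq> C v" if "u \<in> Q1" "v \<in> V" "E u v" for u v
  proof -
    have "v \<in> Q1 \<union> Q2 \<union> Q5 \<union> R2"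
      using nonadj(1)[OF that(1)] that(2,3) V_eq by blast
    then consider "v \<in> Q1" | "v \<in> Q2" | "v \<in> Q5" | "v \<in> R2" by blast
    then show ?thesis
    proof cases
      case 1
      then show ?thesis using sameQ1[of u v] that by simp
    next
      case 2
      then show ?thesis using dis1[of u v] C(1)[of u] C(2)[of v] that by simp
    next
      case 3
      then show ?thesis using dis2[of u v] C(1)[of u] C(5)[of v] that by simp
    next
      case 4
      then show ?thesis using g'(1)[of v u] C(1)[of u] C(6)[of v] that by simp
    qed
  qed
  have row4: "C u \<noteq> C v" if "u \<in> Q4" "v \<in> V" "E u v" for u v
  proof -
    have "v \<in> Q4 \<union> Q3 \<union> Q5 \<union> R3"
      using nonadj(2)[OF that(1)] that(2,3) V_eq by blast
    then consider "v \<in> Q4" | "v \<in> Q3" | "v \<in> Q5" | "v \<in> R3" by blast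
    then show ?thesis
    proof cases
      case 1
      then show ?thesis using sameQ4[of u v] that by simp
    next
      case 2
      then show ?thesis using dis3[of u v] C(4)[of u] C(3)[of v] that by simp
    next
      case 3
      then show ?thesis using dis4[of u v] C(4)[of u] C(5)[of v] that by simp
    next
      case 4
      then show ?thesis using h'(1)[of v u] C(4)[of u] C(7)[of v] that by simp
    qed
  qed
  have row2: "C u \<noteq> C v" if "u \<in> Q2 \<union> R2" "v \<in> Q2 \<union> R2" "E u v" for u v
    using that sameQ2[of u v] C(2,6)[of u] C(2,6)[of v] g'(2)[of u v] g'(2)[of v u] g'(4)[of u v]
    by (elim UnE) simp_all
  have row3: "C u \<noteq> C v" if "u \<in> Q3 \<union> R3" "v \<in> Q3 \<union> R3" "E u v" for u v
    using that sameQ3[of u v] C(3,7)[of u] C(3,7)[of v] h'(2)[of u v] h'(2)[of v u] h'(4)[of u v]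
    by (elim UnE) simp_all
  have row23: "C u \<noteq> C v" if "u \<in> Q2 \<union> R2" "v \<in> Q3 \<union> R3" "E u v" for u v
    using that c23 C(2,6)[of u] C(3,7)[of v] g'(3)[of u v] h'(3)[of v u] sym[of u v]
      R2_R3_nonadjacent[of u v]
    by (elim UnE) simp_all
  have row5: "C u \<noteq> C v" if "u \<in> Q5" "v \<in> Q5 \<union> (Q2 \<union> R2) \<union> (Q3 \<union> R3)" "E u v" for u v
    using that nonadj(3)[of u v] sameQ5[of u v] by blast
  have "C u \<noteq> C v" if uv: "u \<in> V" "v \<in> V" "E u v" for u v
  proof -
    have vu: "E v u" using uv(3) by (rule sym)
    consider "u \<in> Q1 \<union> Q4" | "v \<in> Q1 \<union> Q4"
      | "u \<in> Q5 \<union> (Q2 \<union> R2) \<union> (Q3 \<union> R3)" "v \<in> Q5 \<union> (Q2 \<union> R2) \<union> (Q3 \<union> R3)"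
      using uv V_eq by blast
    then show ?thesis
    proof cases
      case 1
      then show ?thesis using row1[OF _ uv(2,3)] row4[OF _ uv(2,3)] by blast
    next
      case 2
      then have "C v \<noteq> C u" using row1[OF _ uv(1) vu] row4[OF _ uv(1) vu] by blast
      then show ?thesis by simp
    next
      case 3
      have "u \<in> Q5 \<Longrightarrow> C u \<noteq> C v" using row5 3 uv(3) by blast
      moreover have "v \<in> Q5 \<Longrightarrow> C v \<noteq> C u" using row5 3 vu by blast
      moreover have "v \<in> Q2 \<union> R2 \<Longrightarrow> u \<in> Q3 \<union> R3 \<Longrightarrow> C v \<noteq> C u" using row23 vu by blast
      ultimately show ?thesis
        using 3 row2[OF _ _ uv(3)] row3[OF _ _ uv(3)] row23[OF _ _ uv(3)] by (metis UnE)
    qed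
  qed
  moreover have "C v < k" if "v \<in> V" for v
    using that C[of v] lt g h by (auto simp: V_eq)
  ultimately show ?thesis unfolding proper_colouring_def by blast
qed

end

section \<open>The bound in terms of the clique number\<close>

lemma card_clique_le:
  assumes "finite V" "K \<subseteq> V" "is_clique E K"
  shows "card K \<le> clique_number V E"
proof -
  have "{card K | K. K \<subseteq> V \<and> is_clique E K} \<subseteq> card ` Pow V" by blast
  then have "finite {card K | K. K \<subseteq> V \<and> is_clique E K}"
    by (rule finite_subset) (use assms(1) in simp)
  then show ?thesis unfolding clique_number_def by (rule Max_ge) (use assms in blast)
qed

theorem theorem5p15:
  fixes V :: "'a set" and E :: "'a \<Rightarrow> 'a \<Rightarrow> bool"
  assumes "belt V E"
  shows "real (chromatic_number V E) \<le> real_of_int \<lceil>5 * real (clique_number V E) / 4\<rceil>"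
proof -
  obtain Q1 Q2 Q3 Q4 Q5 R2 R3 where "belt_partition V E Q1 Q2 Q3 Q4 Q5 R2 R3"
    using assms unfolding belt_def by blast
  then interpret belt_graph V E Q1 Q2 Q3 Q4 Q5 R2 R3 by unfold_locales
  let ?w = "clique_number V E"
  define k where "k = nat \<lceil>5 * real ?w / 4\<rceil>"
  have k: "real_of_int \<lceil>5 * real ?w / 4\<rceil> = real k" unfolding k_def by simp
  then have "5 * real ?w / 4 \<le> real k" by (metis le_of_int_ceiling)
  then have "5 * ?w \<le> 4 * k" by linarith
  then have "\<exists>f. proper_colouring V E k f"
    using colourable[of ?w k] card_clique_le[OF finV] by blast
  then have "chromatic_number V E \<le> k" unfolding chromatic_number_def by (rule Least_le)
  then show ?thesis using k by simp
qed

end
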